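(* For every integer $n\ge 2$, $\theta(K_n\times K_2)=\lceil n/4\rceil$.
   Context: The thickness $\theta(G)$ of a graph $G$ is the minimum number of planar subgraphs whose union is $G$. The Kronecker product $G\times H$ of graphs $G$ and $H$ is the graph with vertex set $V(G)\times V(H)$ in which $(g,h)$ and $(g',h')$ are adjacent if and only if $gg'\in E(G)$ and $hh'\in E(H)$. $K_n$ denotes the complete graph on $n$ vertices. *)

theory Defs
  imports "HOL-Analysis.Analysis"
begin

definition simple_graph :: "'a set \<Rightarrow> 'a set set \<Rightarrow> bool" where
  "simple_graph V E \<longleftrightarrow> finite V \<and> (\<forall>e\<in>E. e \<subseteq> V \<and> card e = 2)"

definition planar :: "'a set \<Rightarrow> 'a set set \<Rightarrow> bool" where
  "planar V E \<longleftrightarrow>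
     (\<exists>(pos :: 'a \<Rightarrow> complex) (arcs :: 'a set \<Rightarrow> real \<Rightarrow> complex).
        inj_on pos V \<and>
        (\<forall>e\<in>E. arc (arcs e) \<and>
                {pathstart (arcs e), pathfinish (arcs e)} = pos ` e \<and>
                path_image (arcs e) \<inter> pos ` V = pos ` e) \<and>
        (\<forall>e\<in>E. \<forall>e'\<in>E. e \<noteq> e' \<longrightarrow>
                path_image (arcs e) \<inter> path_image (arcs e') \<subseteq> pos ` (e \<inter> e')))"

definition thickness :: "'a set \<Rightarrow> 'a set set \<Rightarrow> nat" where
  "thickness V E = (LEAST k. \<exists>F :: nat \<Rightarrow> 'a set set.
       (\<forall>i<k. F i \<subseteq> E \<and> planar V (F i)) \<and> (\<Union>i<k. F i) = E)"

definition complete_edges :: "'a set \<Rightarrow> 'a set set" where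
  "complete_edges V = {{u, v} | u v. u \<in> V \<and> v \<in> V \<and> u \<noteq> v}"

definition kron_edges :: "'a set set \<Rightarrow> 'b set set \<Rightarrow> ('a \<times> 'b) set set" where
  "kron_edges EG EH = {{(g, h), (g', h')} | g h g' h'. {g, g'} \<in> EG \<and> {h, h'} \<in> EH}"

end

theory Submission
  imports Defs
begin

text \<open>
  Lower bound. A triangle-free plane graph on \<open>N \<ge> 2\<close> vertices has at most \<open>2 N - 2\<close> edges, while
  \<open>K\<^sub>n \<times> K\<^sub>2\<close> is bipartite with \<open>2 n\<close> vertices and \<open>n (n - 1)\<close> edges. The edge bound is proved without
  Euler's formula: inside a cycle of length \<open>c\<close> with \<open>i\<close> vertices in its interior there are at most
  \<open>2 i + c / 2 - 2\<close> edges. If a path through the interior joins two vertices of the cycle, the theta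
  curve theorem splits the interior and the two bounds add up; otherwise every component of the
  interior graph sees at most one vertex of the cycle and has few edges by induction on the number of
  vertices. An inversion of the plane exchanges the inside and the outside of a cycle.

  Upper bound. Layer \<open>r\<close> consists of the cube \<open>K\<^sub>4 \<times> K\<^sub>2\<close> on the eight vertices \<open>(x, s)\<close> with
  \<open>x div 4 = r\<close>, drawn with four of its faces between two concentric squares, and of the remaining
  vertices, each placed in one of these four faces and joined to two opposite corners of it.
\<close>

section \<open>Paths and cycles as vertex lists\<close>

fun path_edges :: "'a list \<Rightarrow> 'a set set" where
  "path_edges (x # y # zs) = insert {x, y} (path_edges (y # zs))"
| "path_edges _ = {}"

text \<open>The list is closed up by repeating its first vertex. This is a graph cycle only from
  length 3 on: \<open>[x, y]\<close> yields a single edge.\<close>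

definition cycle_edges :: "'a list \<Rightarrow> 'a set set" where
  "cycle_edges xs = path_edges (xs @ [hd xs])"

section \<open>Concatenating, reversing and rotating vertex lists\<close>

lemma path_edges_Cons:
  "xs \<noteq> [] \<Longrightarrow> path_edges (x # xs) = insert {x, hd xs} (path_edges xs)"
  by (cases xs) auto

lemma path_edges_append:
  "path_edges (xs @ y # ys) = path_edges (xs @ [y]) \<union> path_edges (y # ys)"
proof (induction xs)
  case (Cons x xs)
  then show ?case by (simp add: path_edges_Cons hd_append)
qed simp

lemma path_edges_rev: "path_edges (rev xs) = path_edges xs"
proof (induction xs rule: path_edges.induct)
  case (1 x y zs)
  then show ?case
    using path_edges_append[of "rev zs" y "[x]"] by (auto simp: insert_commute)
qed auto

lemma finite_path_edges: "finite (path_edges xs)"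
  by (induction xs rule: path_edges.induct) auto

lemma card_path_edges: "card (path_edges xs) \<le> length xs - 1"
proof (induction xs rule: path_edges.induct)
  case (1 x y zs)
  then show ?case
    using card_insert_le_m1[of "Suc (length zs)" "path_edges (y # zs)" "{x, y}"] by simp
qed auto

lemma path_edges_subset: "e \<in> path_edges xs \<Longrightarrow> e \<subseteq> set xs"
  by (induction xs rule: path_edges.induct) auto

lemma Union_path_edges: "length xs \<ge> 2 \<Longrightarrow> \<Union> (path_edges xs) = set xs"
proof (induction xs rule: path_edges.induct)
  case (1 x y zs)
  then show ?case by (cases zs) auto
qed auto

lemma cycle_edges_rotate:
  "cycle_edges (us @ a # ws) = cycle_edges (a # ws @ us)"
proof (cases us)
  case (Cons u us')
  have "cycle_edges (us @ a # ws) = path_edges (us @ [a]) \<union> path_edges (a # ws @ [u])"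
    using path_edges_append[of us a "ws @ [u]"] by (simp add: cycle_edges_def Cons)
  moreover have "cycle_edges (a # ws @ us) = path_edges (a # ws @ [u]) \<union> path_edges (us @ [a])"
    using path_edges_append[of "a # ws" u "us' @ [a]"] by (simp add: cycle_edges_def Cons)
  ultimately show ?thesis by blast
qed simp

lemma cycle_edges_split:
  "cycle_edges (a # xs @ b # ys) = path_edges (a # xs @ [b]) \<union> path_edges (b # ys @ [a])"
  using path_edges_append[of "a # xs" b "ys @ [a]"] by (simp add: cycle_edges_def)

lemma finite_cycle_edges: "finite (cycle_edges xs)"
  by (simp add: cycle_edges_def finite_path_edges)

lemma card_cycle_edges: "card (cycle_edges xs) \<le> length xs"
  unfolding cycle_edges_def using card_path_edges[of "xs @ [hd xs]"] by simp

lemma Union_cycle_edges: "xs \<noteq> [] \<Longrightarrow> \<Union> (cycle_edges xs) = set xs"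
  unfolding cycle_edges_def by (subst Union_path_edges) (auto simp: Suc_le_eq)

text \<open>All neighbours of the first vertex of a longest path lie on that path; an edge to a
  neighbour other than the second vertex closes a cycle.\<close>

lemma ex_cycle:
  assumes fin: "finite V" and "V \<noteq> {}" and sub: "\<And>e. e \<in> E \<Longrightarrow> e \<subseteq> V"
    and two: "\<And>e. e \<in> E \<Longrightarrow> card e = 2"
    and deg: "\<And>v. v \<in> V \<Longrightarrow> 2 \<le> card {e \<in> E. v \<in> e}"
  obtains vs where "distinct vs" "length vs \<ge> 3" "cycle_edges vs \<subseteq> E"
proof -
  let ?P = "\<lambda>xs. distinct xs \<and> xs \<noteq> [] \<and> set xs \<subseteq> V \<and> path_edges xs \<subseteq> E"
  obtain v where "v \<in> V" using \<open>V \<noteq> {}\<close> by blast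
  then have P1: "?P [v]" by simp
  have bd: "\<forall>xs. ?P xs \<longrightarrow> length xs < Suc (card V)"
    by (metis distinct_card card_mono fin less_Suc_eq_le)
  obtain p where p: "?P p" and mx: "\<And>xs. ?P xs \<Longrightarrow> length xs \<le> length p"
    using ex_has_greatest_nat[of ?P, OF P1 bd] by blast
  obtain x xs where px: "p = x # xs" using p by (cases p) auto
  have nb: "w \<in> set xs" if "{x, w} \<in> E" for w
  proof (rule ccontr)
    assume "w \<notin> set xs"
    moreover have "w \<noteq> x" using two[OF that] by auto
    ultimately have "?P (w # p)"
      using p sub[OF that] that by (auto simp: px insert_commute)
    then have "length (w # p) \<le> length p" by (rule mx)
    then show False by simp
  qed
  \<comment> \<open>Otherwise every edge at \<open>x\<close> equals \<open>{x, hd xs}\<close>. For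
    empty \<open>xs\<close> the value of \<open>hd xs\<close> is unspecified, but the degree of
    \<open>x\<close> is still at most 1.\<close>
  have "\<exists>w. {x, w} \<in> E \<and> w \<noteq> hd xs"
  proof (rule ccontr)
    assume a: "\<not> ?thesis"
    have "{e \<in> E. x \<in> e} \<subseteq> {{x, hd xs}}"
    proof clarify
      fix e assume e: "e \<in> E" "x \<in> e"
      then obtain w where "e = {x, w}"
        using two[OF e(1)] by (auto simp: card_2_iff)
      then show "e = {x, hd xs}" using a e by auto
    qed
    then have "card {e \<in> E. x \<in> e} \<le> 1"
      by (metis card_mono finite.emptyI finite_insert is_singletonI is_singleton_altdef)
    then show False using deg[of x] p px by simp
  qed
  then obtain w where w: "{x, w} \<in> E" "w \<noteq> hd xs" by blast
  obtain us ws where us: "xs = us @ w # ws" using nb[OF w(1)] split_list[of w xs] by blast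
  have "us \<noteq> []" using w us by auto
  have "path_edges p = path_edges ((x # us) @ [w]) \<union> path_edges (w # ws)"
    using path_edges_append[of "x # us" w ws] by (simp add: px us)
  moreover have "cycle_edges (x # us @ [w]) = path_edges ((x # us) @ [w]) \<union> {{x, w}}"
    using path_edges_append[of "x # us" w "[x]"] by (auto simp: cycle_edges_def insert_commute)
  ultimately have "cycle_edges (x # us @ [w]) \<subseteq> E" using p w by auto
  moreover have "distinct (x # us @ [w])" using p px us by auto
  moreover have "length (x # us @ [w]) \<ge> 3" using \<open>us \<noteq> []\<close> by (cases us) auto
  ultimately show thesis using that by blast
qed

text \<open>Induction along the walk; a vertex that is met again cuts the path back to that
  vertex.\<close>

lemma rtrancl_simple_path:
  assumes "(x, y) \<in> {(u, v). u \<in> W \<and> v \<in> W \<and> {u, v} \<in> D}\<^sup>*" "x \<in> W"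
  obtains p where "distinct p" "p \<noteq> []" "hd p = x" "last p = y" "set p \<subseteq> W" "path_edges p \<subseteq> D"
proof -
  have "\<exists>p. distinct p \<and> p \<noteq> [] \<and> hd p = x \<and> last p = y \<and> set p \<subseteq> W \<and> path_edges p \<subseteq> D"
    using assms(1)
  proof (induction rule: rtrancl_induct)
    case base
    show ?case by (rule exI[of _ "[x]"]) (use assms in auto)
  next
    case (step y z)
    then obtain p where p: "distinct p" "p \<noteq> []" "hd p = x" "last p = y" "set p \<subseteq> W"
      "path_edges p \<subseteq> D" by blast
    show ?case
    proof (cases "z \<in> set p")
      case True
      then obtain us ws where us: "p = us @ z # ws" using split_list[of z p] by blast
      have "path_edges (us @ [z]) \<subseteq> D" using p(6) path_edges_append[of us z ws] us by simp
      moreover have "hd (us @ [z]) = x" using p(3) us by (cases us) auto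
      ultimately show ?thesis using p(1,5) us by (intro exI[of _ "us @ [z]"]) simp
    next
      case False
      have us: "p = butlast p @ [y]" using p by (metis append_butlast_last_id)
      then have "path_edges (p @ [z]) = path_edges p \<union> {{y, z}}"
        using path_edges_append[of "butlast p" y "[z]"] by (metis append_Cons append_Nil append_assoc
            path_edges.simps(1,3))
      then show ?thesis using p False step(2) by (intro exI[of _ "p @ [z]"]) simp
    qed
  qed
  then show thesis using that by blast
qed

text \<open>If no path through \<open>W\<close> joins two vertices of \<open>S\<close>, then every component of \<open>W\<close> sees at most
  one vertex of \<open>S\<close>, so that the local sparsity assumption can be summed over the components.\<close>

lemma card_edges_no_ear:
  assumes "finite W" "finite D"
    and "\<And>e. e \<in> D \<Longrightarrow> e \<subseteq> W \<union> S \<and> card e = 2"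
    and "W \<inter> S = {}"
    and "\<And>a b p. a \<in> S \<Longrightarrow> b \<in> S \<Longrightarrow> a \<noteq> b \<Longrightarrow> distinct p \<Longrightarrow> set p \<subseteq> W
           \<Longrightarrow> path_edges (a # p @ [b]) \<subseteq> D \<Longrightarrow> False"
    and "\<And>X. X \<subseteq> W \<union> S \<Longrightarrow> finite X \<Longrightarrow> card (X \<inter> S) \<le> 1 \<Longrightarrow> card X \<ge> 2
           \<Longrightarrow> card {e \<in> D. e \<subseteq> X} + 2 \<le> 2 * card X"
  shows "card D \<le> 2 * card W"
  using assms
proof (induction "card W" arbitrary: W D rule: less_induct)
  case less
  note fin = less.prems(1,2) and ends = less.prems(3) and disj = less.prems(4)
    and noear = less.prems(5) and sparse = less.prems(6)
  show ?case
  proof (cases "W = {}")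
    case True
    have "D = {}"
    proof (rule ccontr)
      assume "D \<noteq> {}"
      then obtain e where e: "e \<in> D" by blast
      then obtain a b where "e = {a, b}" "a \<noteq> b" using ends[OF e] by (auto simp: card_2_iff)
      then show False using noear[of a b "[]"] ends[OF e] e True by auto
    qed
    then show ?thesis by simp
  next
    case False
    then obtain x where x: "x \<in> W" by blast
    define r where "r = {(u, v). u \<in> W \<and> v \<in> W \<and> {u, v} \<in> D}"
    \<comment> \<open>\<open>K\<close> is the component of \<open>x\<close> in the graph on
      \<open>W\<close>, and \<open>T\<close> the set of its neighbours in \<open>S\<close>.\<close>
    define K where "K = {y. (x, y) \<in> r\<^sup>*}"
    define T where "T = {s \<in> S. \<exists>y\<in>K. {y, s} \<in> D}"
    have KW: "K \<subseteq> W"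
    proof
      fix y assume "y \<in> K"
      then have "(x, y) \<in> r\<^sup>*" by (simp add: K_def)
      then show "y \<in> W" by (induction) (auto simp: x r_def)
    qed
    have xK: "x \<in> K" by (simp add: K_def)
    have symr: "sym (r\<^sup>*)"
      by (intro sym_rtrancl) (auto simp: sym_def r_def insert_commute)
    \<comment> \<open>Two different vertices of \<open>T\<close> would be joined by a path through
      the component, which is excluded by \<open>noear\<close>.\<close>
    have T1: "s = s'" if sT: "s \<in> T" "s' \<in> T" for s s'
    proof (rule ccontr)
      assume ne: "s \<noteq> s'"
      obtain y y' where y: "y \<in> K" "{y, s} \<in> D" "y' \<in> K" "{y', s'} \<in> D"
        using sT by (auto simp: T_def)
      have "(y, y') \<in> r\<^sup>*"
        using y symr unfolding K_def by (metis mem_Collect_eq rtrancl_trans symD)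
      then obtain p where p: "distinct p" "p \<noteq> []" "hd p = y" "last p = y'" "set p \<subseteq> W"
        "path_edges p \<subseteq> D"
        using rtrancl_simple_path[of y y' W D] y KW unfolding r_def by blast
      obtain us where us: "p = us @ [y']" using p by (metis append_butlast_last_id)
      have "path_edges (s # p @ [s']) = insert {s, y} (path_edges (us @ [y', s']))"
        using p(2,3) us by (simp add: path_edges_Cons hd_append split: if_splits)
      then have "path_edges (s # p @ [s']) \<subseteq> D"
        using p(6) y path_edges_append[of us y' "[s']"] us by (simp add: insert_commute)
      then show False using noear[of s s' p] ne sT p by (auto simp: T_def)
    qed
    have fT: "finite T" and cT: "card T \<le> 1"
    proof -
      have "T \<subseteq> {SOME s. s \<in> T}" using T1 by (metis singletonI someI subsetI)
      then show "finite T" "card T \<le> 1"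
        by (auto intro: finite_subset dest: card_mono[rotated])
    qed
    have fK: "finite K" using KW fin finite_subset by blast
    have touch: "e \<subseteq> K \<union> T" if e: "e \<in> D" "e \<inter> K \<noteq> {}" for e
    proof -
      obtain y where y: "y \<in> e" "y \<in> K" using e by blast
      then obtain z where z: "e = {y, z}" using ends[OF e(1)] by (auto simp: card_2_iff)
      show ?thesis
      proof (cases "z \<in> W")
        case True
        then have "(y, z) \<in> r" using y z e KW by (auto simp: r_def)
        then show ?thesis using y z unfolding K_def by auto
      next
        case False
        then show ?thesis using ends[OF e(1)] y z e by (auto simp: T_def)
      qed
    qed
    have TS: "T \<subseteq> S" by (auto simp: T_def)
    have XS: "(K \<union> T) \<inter> S = T" using KW TS disj by blast
    have cX: "card (K \<union> T) \<le> card K + 1" using card_Un_le[of K T] cT by linarith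
    \<comment> \<open>\<open>K \<union> T\<close> has at most one vertex more than \<open>K\<close>,
      so its bound \<open>2 * card (K \<union> T) - 2\<close> is at most \<open>2 * card K\<close>;
      fewer than two vertices carry no edge.\<close>
    have b1: "card {e \<in> D. e \<subseteq> K \<union> T} \<le> 2 * card K"
    proof (cases "card (K \<union> T) \<ge> 2")
      case True
      have "K \<union> T \<subseteq> W \<union> S" using KW TS by blast
      then have "card {e \<in> D. e \<subseteq> K \<union> T} + 2 \<le> 2 * card (K \<union> T)"
        using True fK fT XS cT by (intro sparse) auto
      then show ?thesis using cX by linarith
    next
      case False
      have "\<not> e \<subseteq> K \<union> T" if "e \<in> D" for e
        using False ends[OF that] card_mono[of "K \<union> T" e] fK fT by auto
      then have "{e \<in> D. e \<subseteq> K \<union> T} = {}" by blast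
      then show ?thesis by (simp only: card.empty)
    qed
    define D' where "D' = {e \<in> D. e \<inter> K = {}}"
    have fD': "finite D'" using fin by (simp add: D'_def)
    have b2: "card D' \<le> 2 * card (W - K)"
    proof (rule less.hyps)
      show "card (W - K) < card W"
        using xK KW x fin by (intro psubset_card_mono) auto
      show "finite (W - K)" "finite D'" using fin by (auto simp: D'_def)
      show "e \<subseteq> W - K \<union> S \<and> card e = 2" if "e \<in> D'" for e
        using that ends[of e] by (auto simp: D'_def)
      show "(W - K) \<inter> S = {}" using disj by blast
      show False if "a \<in> S" "b \<in> S" "a \<noteq> b" "distinct p" "set p \<subseteq> W - K"
        "path_edges (a # p @ [b]) \<subseteq> D'" for a b p
        using noear[of a b p] that by (auto simp: D'_def)
      show "card {e \<in> D'. e \<subseteq> X} + 2 \<le> 2 * card X"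
        if "X \<subseteq> W - K \<union> S" "finite X" "card (X \<inter> S) \<le> 1" "card X \<ge> 2" for X
      proof -
        have "card {e \<in> D'. e \<subseteq> X} \<le> card {e \<in> D. e \<subseteq> X}"
          using fin by (intro card_mono) (auto simp: D'_def)
        moreover have "card {e \<in> D. e \<subseteq> X} + 2 \<le> 2 * card X"
          using that by (intro sparse) auto
        ultimately show ?thesis by linarith
      qed
    qed
    have "D \<subseteq> D' \<union> {e \<in> D. e \<subseteq> K \<union> T}" using touch by (auto simp: D'_def)
    then have "card D \<le> card (D' \<union> {e \<in> D. e \<subseteq> K \<union> T})"
      using fin fD' by (intro card_mono) auto
    also have "\<dots> \<le> card D' + card {e \<in> D. e \<subseteq> K \<union> T}" by (rule card_Un_le)
    also have "\<dots> \<le> 2 * card (W - K) + 2 * card K" using b1 b2 by linarith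
    also have "\<dots> = 2 * card W"
      using card_Diff_subset[OF fK KW] card_mono[OF fin(1) KW] by simp
    finally show ?thesis .
  qed
qed

section \<open>Edges inside a cycle of a plane graph\<close>

text \<open>Keeps the two halves of a cycle edge-disjoint: the only edge they could share joins
  their common ends.\<close>

lemma path_edges_ends_notin:
  assumes "distinct (a # xs @ [b])" "xs \<noteq> []"
  shows "{a, b} \<notin> path_edges (a # xs @ [b])"
proof -
  have "path_edges (a # xs @ [b]) = insert {a, hd xs} (path_edges (xs @ [b]))"
    using assms by (simp add: path_edges_Cons)
  moreover have "{a, b} \<notin> path_edges (xs @ [b])"
    using path_edges_subset[of "{a, b}" "xs @ [b]"] assms by auto
  moreover have "b \<noteq> hd xs" "a \<noteq> b" using assms by (cases xs; auto)+
  ultimately show ?thesis by (auto simp: doubleton_eq_iff)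
qed

section \<open>Plane drawings and the curves carried by their paths and cycles\<close>

locale plane_drawing =
  fixes V :: "'a set" and E :: "'a set set"
    and pos :: "'a \<Rightarrow> complex" and arcs :: "'a set \<Rightarrow> real \<Rightarrow> complex"
  assumes graph: "simple_graph V E"
    and inj_pos: "inj_on pos V"
    and arc_arcs: "e \<in> E \<Longrightarrow> arc (arcs e)"
    and arc_ends: "e \<in> E \<Longrightarrow> {pathstart (arcs e), pathfinish (arcs e)} = pos ` e"
    and arc_vertices: "e \<in> E \<Longrightarrow> path_image (arcs e) \<inter> pos ` V = pos ` e"
    and arcs_meet: "e \<in> E \<Longrightarrow> e' \<in> E \<Longrightarrow> e \<noteq> e' \<Longrightarrow>
          path_image (arcs e) \<inter> path_image (arcs e') \<subseteq> pos ` (e \<inter> e')"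
begin

definition trace :: "'a set set \<Rightarrow> complex set" where
  "trace F = (\<Union>e\<in>F. path_image (arcs e))"

text \<open>A test point for the side of a cycle on which an edge lies. An edge off the cycle meets
  it at most in its own ends, so every other point of its arc lies on the same side.\<close>

definition mid :: "'a set \<Rightarrow> complex" where
  "mid e = arcs e (1/2)"

definition inner_edges :: "'a set set \<Rightarrow> 'a set set" where
  "inner_edges C = {e \<in> E. mid e \<in> inside (trace C)}"

definition inner_vertices :: "'a set set \<Rightarrow> 'a set" where
  "inner_vertices C = {v \<in> V. pos v \<in> inside (trace C)}"

lemma finite_V: "finite V" and edge_subset: "e \<in> E \<Longrightarrow> e \<subseteq> V" and edge_card: "e \<in> E \<Longrightarrow> card e = 2"
  using graph by (auto simp: simple_graph_def)

lemma finite_E: "finite E"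
  using finite_subset[of E "Pow V"] finite_V edge_subset by auto

lemma trace_Un: "trace (F \<union> G) = trace F \<union> trace G"
  by (auto simp: trace_def)

lemma mid_in_image: "mid e \<in> path_image (arcs e)"
  by (auto simp: mid_def path_image_def)

lemma mid_not_vertex:
  assumes "e \<in> E" shows "mid e \<notin> pos ` V"
proof
  assume "mid e \<in> pos ` V"
  then have "mid e \<in> pos ` e" using arc_vertices[OF assms] mid_in_image by blast
  then have "arcs e (1/2) = arcs e 0 \<or> arcs e (1/2) = arcs e 1"
    using arc_ends[OF assms] by (auto simp: mid_def pathstart_def pathfinish_def)
  then show False
    using arc_imp_inj_on[OF arc_arcs[OF assms]] by (auto dest: inj_onD)
qed

lemma mid_in_trace_iff:
  assumes "e \<in> E" "F \<subseteq> E"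
  shows "mid e \<in> trace F \<longleftrightarrow> e \<in> F"
proof
  assume "mid e \<in> trace F"
  then obtain f where f: "f \<in> F" "mid e \<in> path_image (arcs f)" by (auto simp: trace_def)
  show "e \<in> F"
  proof (rule ccontr)
    assume "e \<notin> F"
    then have "mid e \<in> pos ` (e \<inter> f)"
      using f assms arcs_meet[of e f] mid_in_image[of e] by blast
    then show False using mid_not_vertex[OF assms(1)] edge_subset[OF assms(1)] by blast
  qed
next
  assume "e \<in> F" then show "mid e \<in> trace F" using mid_in_image by (auto simp: trace_def)
qed

lemma pos_in_trace_iff:
  assumes "v \<in> V" "F \<subseteq> E"
  shows "pos v \<in> trace F \<longleftrightarrow> v \<in> \<Union>F"
proof
  assume "pos v \<in> trace F"
  then obtain f where f: "f \<in> F" "pos v \<in> path_image (arcs f)" by (auto simp: trace_def)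
  then have "pos v \<in> pos ` f" using assms arc_vertices[of f] by blast
  then show "v \<in> \<Union>F"
    using inj_pos f assms edge_subset[of f] by (metis UnionI inj_on_image_mem_iff subsetD)
next
  assume "v \<in> \<Union>F"
  then obtain f where f: "f \<in> F" "v \<in> f" by blast
  then have "pos v \<in> path_image (arcs f)" using assms arc_vertices[of f] by blast
  then show "pos v \<in> trace F" using f by (auto simp: trace_def)
qed

lemma trace_Int_subset:
  assumes "F \<subseteq> E" "G \<subseteq> E" "F \<inter> G = {}"
  shows "trace F \<inter> trace G \<subseteq> pos ` (\<Union>F \<inter> \<Union>G)"
proof
  fix x assume "x \<in> trace F \<inter> trace G"
  then obtain f g where fg: "f \<in> F" "g \<in> G" "x \<in> path_image (arcs f)" "x \<in> path_image (arcs g)"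
    by (auto simp: trace_def)
  then have "x \<in> pos ` (f \<inter> g)" using arcs_meet[of f g] assms by blast
  then show "x \<in> pos ` (\<Union>F \<inter> \<Union>G)" using fg by blast
qed

text \<open>A drawing gives \<open>arcs {x, y}\<close> an arbitrary direction, so the arc may have
  to be reversed.\<close>

lemma arc_from_to:
  assumes "{x, y} \<in> E" "x \<noteq> y"
  obtains g where "arc g" "path_image g = path_image (arcs {x, y})"
    "pathstart g = pos x" "pathfinish g = pos y"
proof (cases "pathstart (arcs {x, y}) = pos x")
  case True
  have "pos y \<noteq> pos x" using inj_pos edge_subset[OF assms(1)] assms(2) by (auto dest: inj_onD)
  then have "pathfinish (arcs {x, y}) = pos y"
    using arc_ends[OF assms(1)] True by auto
  then show ?thesis using that[of "arcs {x, y}"] True arc_arcs assms by blast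
next
  case False
  then have "pathstart (arcs {x, y}) = pos y" "pathfinish (arcs {x, y}) = pos x"
    using arc_ends[OF assms(1)] by (auto simp: doubleton_eq_iff)
  then show ?thesis
    using that[of "reversepath (arcs {x, y})"] arc_arcs[OF assms(1)] by (simp add: arc_reversepath)
qed

lemma path_trace_arc:
  assumes "distinct xs" "length xs \<ge> 2" "path_edges xs \<subseteq> E"
  obtains g where "arc g" "path_image g = trace (path_edges xs)"
    "pathstart g = pos (hd xs)" "pathfinish g = pos (last xs)"
proof -
  have "\<exists>g. arc g \<and> path_image g = trace (path_edges xs) \<and>
        pathstart g = pos (hd xs) \<and> pathfinish g = pos (last xs)"
    using assms
  proof (induction xs rule: path_edges.induct)
    case (1 x y zs)
    then have xy: "{x, y} \<in> E" "x \<noteq> y" by auto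
    obtain g where g: "arc g" "path_image g = path_image (arcs {x, y})"
      "pathstart g = pos x" "pathfinish g = pos y"
      using arc_from_to[OF xy] .
    show ?case
    proof (cases "zs = []")
      case True
      then show ?thesis using g by (intro exI[of _ g]) (simp add: trace_def)
    next
      case False
      then obtain h where h: "arc h" "path_image h = trace (path_edges (y # zs))"
        "pathstart h = pos y" "pathfinish h = pos (last zs)"
        using 1 by (cases zs) auto
      have "trace {{x, y}} \<inter> trace (path_edges (y # zs)) \<subseteq>
            pos ` (\<Union>{{x, y}} \<inter> \<Union>(path_edges (y # zs)))"
        using 1 path_edges_subset[of "{x, y}" "y # zs"] by (intro trace_Int_subset) auto
      also have "\<dots> \<subseteq> {pos y}"
        using 1 path_edges_subset[of _ "y # zs"] by auto
      finally have "path_image g \<inter> path_image h \<subseteq> {pathstart h}"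
        using g h by (simp add: trace_def)
      then have "arc (g +++ h)" using g h by (intro arc_join) auto
      moreover have "path_image (g +++ h) = trace (path_edges (x # y # zs))"
        using g h by (simp add: path_image_join trace_def)
      ultimately show ?thesis using g h False by (intro exI[of _ "g +++ h"]) auto
    qed
  qed auto
  then show thesis using that by blast
qed

text \<open>A common edge would have to be \<open>{a, b}\<close>, and a path with an inner vertex
  does not contain it; \<open>ne\<close> excludes that both paths are this single edge.\<close>

lemma two_paths_Int:
  assumes d: "distinct (a # xs @ b # ys)" and ne: "xs \<noteq> [] \<or> ys \<noteq> []"
    and E: "path_edges (a # xs @ [b]) \<subseteq> E" "path_edges (b # ys @ [a]) \<subseteq> E"
  shows "trace (path_edges (a # xs @ [b])) \<inter> trace (path_edges (b # ys @ [a])) = {pos a, pos b}"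
    (is "trace ?F \<inter> trace ?G = _")
proof
  have disj: "?F \<inter> ?G = {}"
  proof (rule ccontr)
    assume "?F \<inter> ?G \<noteq> {}"
    then obtain e where e: "e \<in> ?F" "e \<in> ?G" by blast
    then have "e \<subseteq> {a, b}"
      using path_edges_subset[OF e(1)] path_edges_subset[OF e(2)] d by auto
    moreover have "card e = 2" using e E edge_card by blast
    moreover have "card {a, b} = 2" using d by auto
    ultimately have "e = {a, b}" by (metis card_subset_eq finite.emptyI finite_insert)
    then show False
      using ne e path_edges_ends_notin[of a xs b] path_edges_ends_notin[of b ys a] d
      by (auto simp: insert_commute)
  qed
  have U: "\<Union>?F = set (a # xs @ [b])" "\<Union>?G = set (b # ys @ [a])"
    by (rule Union_path_edges; simp)+
  have "\<Union>?F \<inter> \<Union>?G = {a, b}"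
    unfolding U using d by auto
  then show "trace ?F \<inter> trace ?G \<subseteq> {pos a, pos b}"
    using trace_Int_subset[OF E disj] by simp
  have "\<Union>?F \<subseteq> V" using E edge_subset by blast
  then have "a \<in> V" "b \<in> V" unfolding U by auto
  then show "{pos a, pos b} \<subseteq> trace ?F \<inter> trace ?G"
    using pos_in_trace_iff E U by auto
qed

lemma cycle_trace_curve:
  assumes "distinct vs" "length vs \<ge> 3" "cycle_edges vs \<subseteq> E"
  obtains g where "simple_path g" "pathfinish g = pathstart g" "path_image g = trace (cycle_edges vs)"
proof -
  obtain a xs b where vs: "vs = a # xs @ [b]" "xs \<noteq> []"
    using assms(2) by (cases vs; cases "tl vs" rule: rev_cases) (force simp: Suc_le_eq)+
  have C: "cycle_edges vs = path_edges (a # xs @ [b]) \<union> path_edges (b # [] @ [a])"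
    using cycle_edges_split[of a xs b "[]"] vs by simp
  obtain g where g: "arc g" "path_image g = trace (path_edges (a # xs @ [b]))"
    "pathstart g = pos a" "pathfinish g = pos b"
    using path_trace_arc[of "a # xs @ [b]"] assms C vs by auto
  obtain h where h: "arc h" "path_image h = trace (path_edges (b # [] @ [a]))"
    "pathstart h = pos b" "pathfinish h = pos a"
    using path_trace_arc[of "b # [] @ [a]"] assms C vs by auto
  have "path_image g \<inter> path_image h = {pos a, pos b}"
    unfolding g h using assms vs C by (intro two_paths_Int) auto
  then have "simple_path (g +++ h)" using g h by (intro simple_path_join_loop) auto
  moreover have "path_image (g +++ h) = trace (cycle_edges vs)"
    unfolding C trace_Un using g h by (simp add: path_image_join)
  ultimately show thesis using that[of "g +++ h"] g h by simp
qed

text \<open>By the theta curve theorem the ear \<open>P\<close> divides the inside of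
  \<open>C\<close> into the insides of \<open>C1\<close> and \<open>C2\<close>. Strictness of the
  edge inclusions drives an induction, and disjointness of the vertex sets lets the bounds for
  \<open>C1\<close> and \<open>C2\<close> be added.\<close>

lemma ear_split:
  fixes a b :: 'a and xs ys ps :: "'a list"
  defines "C \<equiv> cycle_edges (a # xs @ b # ys)" and "P \<equiv> path_edges (a # ps @ [b])"
    and "C1 \<equiv> cycle_edges (a # xs @ b # rev ps)" and "C2 \<equiv> cycle_edges (b # ys @ a # ps)"
  assumes d: "distinct (a # xs @ b # ys)" and len: "xs \<noteq> [] \<or> ys \<noteq> []" and CE: "C \<subseteq> E"
    and p: "distinct ps" "set ps \<subseteq> inner_vertices C" "P \<subseteq> inner_edges C"
  shows "distinct (a # xs @ b # rev ps)" "distinct (b # ys @ a # ps)"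
    "xs \<noteq> [] \<or> ps \<noteq> []" "ys \<noteq> [] \<or> ps \<noteq> []" "C1 \<subseteq> E" "C2 \<subseteq> E"
    "inner_edges C \<subseteq> inner_edges C1 \<union> inner_edges C2 \<union> P"
    "inner_edges C1 \<subset> inner_edges C" "inner_edges C2 \<subset> inner_edges C"
    "inner_vertices C1 \<inter> inner_vertices C2 = {}"
    "set ps \<inter> (inner_vertices C1 \<union> inner_vertices C2) = {}"
    "inner_vertices C1 \<union> inner_vertices C2 \<union> set ps \<subseteq> inner_vertices C"
proof -
  define F where "F = path_edges (a # xs @ [b])"
  define G where "G = path_edges (b # ys @ [a])"
  have C: "C = F \<union> G" by (simp add: C_def F_def G_def cycle_edges_split)
  have revP: "path_edges (b # rev ps @ [a]) = P"
    using path_edges_rev[of "a # ps @ [b]"] by (simp add: P_def)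
  have C1: "C1 = F \<union> P" by (simp add: C1_def F_def cycle_edges_split revP)
  have C2: "C2 = G \<union> P" by (simp add: C2_def P_def G_def cycle_edges_split)
  have FE: "F \<subseteq> E" "G \<subseteq> E" "P \<subseteq> E" using CE C p by (auto simp: inner_edges_def)
  have UC: "\<Union>C = set (a # xs @ b # ys)" unfolding C_def by (rule Union_cycle_edges) simp
  have no: "x \<notin> trace A" if "x \<in> inside (trace A)" for x A
    using that inside_no_overlap[of "trace A"] by blast
  have off: "set ps \<inter> \<Union>C = {}"
    using p(2) no[of _ C] pos_in_trace_iff[OF _ CE] unfolding inner_vertices_def by blast
  show d1: "distinct (a # xs @ b # rev ps)" and d2: "distinct (b # ys @ a # ps)"
    using d p off UC by auto
  \<comment> \<open>An ear that is a single edge is not an edge of \<open>C\<close>, since its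
    midpoint is inside; so \<open>C1\<close> and \<open>C2\<close> have length at least 3.\<close>
  have notP: "{a, b} \<notin> C" if "ps = []"
  proof
    assume "{a, b} \<in> C"
    moreover have "{a, b} \<in> inner_edges C" using p that by (simp add: P_def)
    ultimately show False
      using mid_in_trace_iff[of "{a, b}" C] CE no by (auto simp: inner_edges_def)
  qed
  show ne1: "xs \<noteq> [] \<or> ps \<noteq> []" using notP by (auto simp: C F_def)
  show ne2: "ys \<noteq> [] \<or> ps \<noteq> []" using notP by (auto simp: C G_def insert_commute)
  show C1E: "C1 \<subseteq> E" and C2E: "C2 \<subseteq> E" using C1 C2 FE by auto
  obtain c1 where c1: "arc c1" "path_image c1 = trace F" "pathstart c1 = pos a" "pathfinish c1 = pos b"
    using path_trace_arc[of "a # xs @ [b]"] d FE F_def by auto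
  obtain c2 where c2: "arc c2" "path_image c2 = trace G" "pathstart c2 = pos b" "pathfinish c2 = pos a"
    using path_trace_arc[of "b # ys @ [a]"] d FE G_def by auto
  obtain c where c: "arc c" "path_image c = trace P" "pathstart c = pos a" "pathfinish c = pos b"
    using path_trace_arc[of "a # ps @ [b]"] d2 FE P_def by auto
  have ab: "pos a \<noteq> pos b" using arc_distinct_ends[OF c(1)] c by auto
  have FG: "trace F \<inter> trace G = {pos a, pos b}"
    unfolding F_def G_def using d len FE by (intro two_paths_Int) (auto simp: F_def G_def)
  have FP: "trace F \<inter> trace P = {pos a, pos b}"
    using two_paths_Int[OF d1] ne1 FE by (simp add: revP F_def)
  have GP: "trace G \<inter> trace P = {pos a, pos b}"
    using two_paths_Int[OF d2] ne2 FE by (auto simp: P_def G_def)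
  \<comment> \<open>An edge of the ear supplies the point inside \<open>C\<close> that the theta
    curve theorem asks for. It also lies on both \<open>C1\<close> and \<open>C2\<close>, which
    makes the inclusions of inner edges strict.\<close>
  obtain e0 where e0: "e0 \<in> P" by (cases ps) (auto simp: P_def)
  then have "mid e0 \<in> trace P \<inter> inside (trace F \<union> trace G)"
    using mid_in_trace_iff[of e0 P] FE p by (auto simp: inner_edges_def C trace_Un)
  then have ne: "path_image c \<inter> inside (path_image c1 \<union> path_image (reversepath c2)) \<noteq> {}"
    using c c1 c2 by auto
  have split: "inside (trace C1) \<inter> inside (trace C2) = {}"
    "inside (trace C1) \<union> inside (trace C2) \<union> (trace P - {pos a, pos b}) = inside (trace C)"
    using split_inside_simple_closed_curve[of c1 "pos a" "pos b" "reversepath c2" c, OF _ _ _ _ _ _ _ _ _ ab _ _ _ ne]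
      c1 c2 c FG FP GP by (auto simp: arc_imp_simple_path arc_reversepath C C1 C2 trace_Un)
  show "inner_edges C \<subseteq> inner_edges C1 \<union> inner_edges C2 \<union> P"
    using split(2) mid_in_trace_iff[OF _ FE(3)] by (fastforce simp: inner_edges_def)
  have "e0 \<notin> inner_edges C1" "e0 \<notin> inner_edges C2"
    using mid_in_trace_iff[of e0 C1] mid_in_trace_iff[of e0 C2] e0 C1 C2 C1E C2E no
    by (auto simp: inner_edges_def)
  then show "inner_edges C1 \<subset> inner_edges C" "inner_edges C2 \<subset> inner_edges C"
    using split(2) e0 p by (auto simp: inner_edges_def)
  show "inner_vertices C1 \<inter> inner_vertices C2 = {}"
    using split(1) by (auto simp: inner_vertices_def)
  have UP: "\<Union>P = set (a # ps @ [b])" unfolding P_def by (rule Union_path_edges) simp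
  have psV: "set ps \<subseteq> V" using p by (auto simp: inner_vertices_def)
  then have "\<And>v. v \<in> set ps \<Longrightarrow> pos v \<in> trace P" using pos_in_trace_iff[OF _ FE(3)] UP by auto
  then show "set ps \<inter> (inner_vertices C1 \<union> inner_vertices C2) = {}"
    using no[of _ C1] no[of _ C2] C1 C2 by (auto simp: inner_vertices_def trace_Un)
  show "inner_vertices C1 \<union> inner_vertices C2 \<union> set ps \<subseteq> inner_vertices C"
    using split(2) p by (auto simp: inner_vertices_def)
qed

text \<open>An edge with its midpoint inside the trace of \<open>C\<close> cannot end outside it: it
  would have to cross the trace, and arcs of different edges meet only at common ends.\<close>

lemma inner_edge_ends:
  assumes e: "e \<in> inner_edges C" and C: "C \<subseteq> E"
  shows "e \<subseteq> inner_vertices C \<union> \<Union>C"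
proof
  fix v assume v: "v \<in> e"
  have eE: "e \<in> E" and mi: "mid e \<in> inside (trace C)" using e by (auto simp: inner_edges_def)
  have vV: "v \<in> V" using v edge_subset eE by blast
  have "e \<notin> C"
    using mi mid_in_trace_iff[OF eE C] inside_no_overlap[of "trace C"] by blast
  show "v \<in> inner_vertices C \<union> \<Union>C"
  proof (rule ccontr)
    assume nv: "v \<notin> inner_vertices C \<union> \<Union>C"
    then have out: "pos v \<in> outside (trace C)"
      using vV pos_in_trace_iff[OF vV C] union_with_inside[of "trace C"]
      by (auto simp: inner_vertices_def)
    have inj: "inj_on (arcs e) {0..1}" and cont: "continuous_on {0..1} (arcs e)"
      using arc_arcs[OF eE] by (auto simp: arc_def path_def)
    have pe: "pos ` e = {arcs e 0, arcs e 1}"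
      using arc_ends[OF eE] by (simp add: pathstart_def pathfinish_def)
    \<comment> \<open>\<open>I\<close> parametrises the arc without the end opposite to
      \<open>v\<close>. A crossing with the trace on this part can only be at \<open>pos v\<close>,
      which puts \<open>v\<close> on \<open>C\<close>.\<close>
    obtain I where I: "connected I" "I \<subseteq> {0..1::real}" "1/2 \<in> I" "pos v \<in> arcs e ` I"
      "\<And>t. t \<in> I \<Longrightarrow> arcs e t \<in> pos ` e \<Longrightarrow> arcs e t = pos v"
    proof -
      have "pos v = arcs e 0 \<or> pos v = arcs e 1" using v pe by auto
      then show thesis
      proof
        assume 0: "pos v = arcs e 0"
        have "arcs e t \<noteq> arcs e 1" if "t \<in> {0..<1}" for t
          using that inj_onD[OF inj, of t 1] by auto
        then show thesis using 0 pe by (intro that[of "{0..<1}"]) auto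
      next
        assume 1: "pos v = arcs e 1"
        have "arcs e t \<noteq> arcs e 0" if "t \<in> {0<..1}" for t
          using that inj_onD[OF inj, of t 0] by auto
        then show thesis using 1 pe by (intro that[of "{0<..1}"]) auto
      qed
    qed
    have "connected (arcs e ` I)"
      using I cont by (intro connected_continuous_image) (auto intro: continuous_on_subset)
    moreover have "inside (trace C) \<inter> arcs e ` I \<noteq> {}" using mi I(3) by (auto simp: mid_def)
    moreover have "outside (trace C) \<inter> arcs e ` I \<noteq> {}" using out I(4) by auto
    ultimately have "trace C \<inter> arcs e ` I \<noteq> {}" by (rule inside_outside_intersect_connected)
    then obtain t f where t: "t \<in> I" "f \<in> C" "arcs e t \<in> path_image (arcs f)"
      by (auto simp: trace_def)
    moreover have "arcs e t \<in> path_image (arcs e)" using t(1) I(2) by (auto simp: path_image_def)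
    ultimately have "arcs e t \<in> pos ` (e \<inter> f)"
      using arcs_meet[OF eE, of f] C \<open>e \<notin> C\<close> by blast
    moreover have "arcs e t = pos v" using calculation by (intro I(5) t) auto
    ultimately have "pos v \<in> pos ` f" by auto
    then have "v \<in> f" using inj_pos vV t C edge_subset[of f] by (metis inj_on_image_mem_iff subsetD)
    then show False using nv t by blast
  qed
qed

text \<open>The bound 2 i + c / 2 - 2, doubled and free of subtraction, by induction on the number
  of inner edges. The hypothesis \<open>sparse\<close> is supplied by an enclosing induction on the
  number of vertices.\<close>

lemma inside_bound:
  assumes tri: "\<And>vs. distinct vs \<Longrightarrow> length vs = 3 \<Longrightarrow> \<not> cycle_edges vs \<subseteq> E"
    and sparse: "\<And>X. X \<subset> V \<Longrightarrow> card X \<ge> 2 \<Longrightarrow> card {e \<in> E. e \<subseteq> X} + 2 \<le> 2 * card X"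
    and "distinct vs" "length vs \<ge> 3" "cycle_edges vs \<subseteq> E"
  shows "2 * card (inner_edges (cycle_edges vs)) + 4
           \<le> 4 * card (inner_vertices (cycle_edges vs)) + length vs"
  using assms(3-5)
proof (induction "card (inner_edges (cycle_edges vs))" arbitrary: vs rule: less_induct)
  case less
  let ?C = "cycle_edges vs"
  let ?D = "inner_edges ?C" and ?W = "inner_vertices ?C"
  note vs = less.prems
  have finI: "finite (inner_edges A)" "finite (inner_vertices A)" for A
    using finite_E finite_V by (auto simp: inner_edges_def inner_vertices_def)
  have UC: "\<Union>?C = set vs" using vs by (intro Union_cycle_edges) auto
  show ?case
  proof (cases "\<exists>a b p. a \<in> set vs \<and> b \<in> set vs \<and> a \<noteq> b \<and> distinct p \<and> set p \<subseteq> ?W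
           \<and> path_edges (a # p @ [b]) \<subseteq> ?D")
    case True
    have "\<exists>a xs b ys p. cycle_edges (a # xs @ b # ys) = ?C \<and> distinct (a # xs @ b # ys) \<and>
            length (a # xs @ b # ys) = length vs \<and> distinct p \<and> set p \<subseteq> ?W \<and>
            path_edges (a # p @ [b]) \<subseteq> ?D"
    proof -
      obtain a b p where ab: "a \<in> set vs" "b \<in> set vs" "a \<noteq> b"
        and p: "distinct p" "set p \<subseteq> ?W" "path_edges (a # p @ [b]) \<subseteq> ?D"
        using True by blast
      obtain us ws where us: "vs = us @ a # ws" using split_list[OF ab(1)] by blast
      then have "b \<in> set (ws @ us)" using ab by auto
      then obtain xs ys where xs: "ws @ us = xs @ b # ys" using split_list by metis
      have eq: "cycle_edges (a # xs @ b # ys) = ?C"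
        using cycle_edges_rotate[of us a ws] us xs by simp
      have "set (a # xs @ b # ys) = set vs"
        unfolding us using xs by (metis Un_commute list.simps(15) set_append Un_insert_right)
      moreover have len: "length (a # xs @ b # ys) = length vs"
        unfolding us using arg_cong[OF xs, of length] by simp
      ultimately have "distinct (a # xs @ b # ys)"
        using vs(1) by (metis card_distinct distinct_card)
      then show ?thesis using eq len p by blast
    qed
    then obtain a xs b ys p where eq: "cycle_edges (a # xs @ b # ys) = ?C"
      and d: "distinct (a # xs @ b # ys)" and len: "length (a # xs @ b # ys) = length vs"
      and p: "distinct p" "set p \<subseteq> ?W" "path_edges (a # p @ [b]) \<subseteq> ?D"
      by blast
    let ?C1 = "cycle_edges (a # xs @ b # rev p)" and ?C2 = "cycle_edges (b # ys @ a # p)"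
    let ?P = "path_edges (a # p @ [b])"
    have ne: "xs \<noteq> [] \<or> ys \<noteq> []" using len vs(2) by auto
    note S = ear_split[OF d ne, unfolded eq, OF vs(3) p]
    have l1: "length (a # xs @ b # rev p) \<ge> 3" and l2: "length (b # ys @ a # p) \<ge> 3"
      using S(3,4) by (auto simp: Suc_le_eq)
    have b1: "2 * card (inner_edges ?C1) + 4 \<le> 4 * card (inner_vertices ?C1) + length (a # xs @ b # rev p)"
      using S(1,5,8) l1 finI by (intro less.hyps) (auto intro: psubset_card_mono)
    have b2: "2 * card (inner_edges ?C2) + 4 \<le> 4 * card (inner_vertices ?C2) + length (b # ys @ a # p)"
      using S(2,6,9) l2 finI by (intro less.hyps) (auto intro: psubset_card_mono)
    have "card ?D \<le> card (inner_edges ?C1 \<union> inner_edges ?C2 \<union> ?P)"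
      using S(7) finI finite_path_edges by (intro card_mono) auto
    also have "\<dots> \<le> card (inner_edges ?C1) + card (inner_edges ?C2) + card ?P"
      by (meson add_le_mono card_Un_le le_refl order_trans)
    finally have eb: "card ?D \<le> card (inner_edges ?C1) + card (inner_edges ?C2) + (length p + 1)"
      using card_path_edges[of "a # p @ [b]"] by simp
    have "card (inner_vertices ?C1) + card (inner_vertices ?C2) + length p
            = card (inner_vertices ?C1 \<union> inner_vertices ?C2) + card (set p)"
      using S(10) finI distinct_card[OF p(1)] by (simp add: card_Un_disjoint)
    also have "\<dots> = card (inner_vertices ?C1 \<union> inner_vertices ?C2 \<union> set p)"
      using S(11) finI by (intro card_Un_disjoint[symmetric]) auto
    also have "\<dots> \<le> card ?W"
      using S(12) finI by (intro card_mono) auto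
    \<comment> \<open>The two cycles together have length
      \<open>length vs + 2 * length p + 2\<close>, the ear has at most \<open>length p + 1\<close>
      edges, and its \<open>length p\<close> vertices are inner for neither of them; with these
      values the constants balance exactly.\<close>
    finally show ?thesis using eb b1 b2 len by simp
  next
    case False
    have "card ?D \<le> 2 * card ?W"
    proof (rule card_edges_no_ear[where S = "set vs"])
      show "finite ?W" "finite ?D" by (rule finI)+
      show "e \<subseteq> ?W \<union> set vs \<and> card e = 2" if "e \<in> ?D" for e
        using inner_edge_ends[OF that vs(3)] that edge_card UC by (auto simp: inner_edges_def)
      show "?W \<inter> set vs = {}"
      proof (rule ccontr)
        assume "?W \<inter> set vs \<noteq> {}"
        then obtain v where "v \<in> V" "pos v \<in> inside (trace ?C)" "v \<in> \<Union>?C"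
          using UC by (auto simp: inner_vertices_def)
        then show False
          using pos_in_trace_iff[OF _ vs(3)] inside_no_overlap[of "trace ?C"] by blast
      qed
      show False if "a \<in> set vs" "b \<in> set vs" "a \<noteq> b" "distinct p" "set p \<subseteq> ?W"
        "path_edges (a # p @ [b]) \<subseteq> ?D" for a b p
        using False that by blast
      show "card {e \<in> ?D. e \<subseteq> X} + 2 \<le> 2 * card X"
        if X: "X \<subseteq> ?W \<union> set vs" "finite X" "card (X \<inter> set vs) \<le> 1" "card X \<ge> 2" for X
      proof -
        have sV: "set vs \<subseteq> V" using UC vs(3) edge_subset by blast
        then have "X \<subseteq> V" using X by (auto simp: inner_vertices_def)
        \<comment> \<open>\<open>X\<close> contains at most one vertex of the cycle, hence misses
          others.\<close>
        moreover have "X \<noteq> V"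
        proof
          assume "X = V"
          then have "X \<inter> set vs = set vs" using sV by blast
          then show False using X(3) vs distinct_card[of vs] by simp
        qed
        ultimately have "card {e \<in> E. e \<subseteq> X} + 2 \<le> 2 * card X" using X by (intro sparse) auto
        moreover have "card {e \<in> ?D. e \<subseteq> X} \<le> card {e \<in> E. e \<subseteq> X}"
          using finite_E by (intro card_mono) (auto simp: inner_edges_def)
        ultimately show ?thesis by linarith
      qed
    qed
    \<comment> \<open>Absence of triangles is used here: a fourth vertex on the cycle pays for the
      constant 4.\<close>
    moreover have "length vs \<ge> 4" using tri[of vs] vs by (cases "length vs = 3") auto
    ultimately show ?thesis by linarith
  qed
qed

end

section \<open>The edge bound for triangle-free planar graphs\<close>

text \<open>The inverse parametrisation would embed a nonempty open subset of the plane in the line,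
  against invariance of dimension. The result serves to find a point off a drawing.\<close>

lemma interior_arc_image:
  fixes g :: "real \<Rightarrow> complex"
  assumes "arc g"
  shows "interior (path_image g) = {}"
proof (rule ccontr)
  assume ne: "interior (path_image g) \<noteq> {}"
  obtain h where h: "homeomorphism {0..1} (path_image g) g h"
    using homeomorphism_arc[OF assms] by blast
  have "continuous_on (interior (path_image g)) h" "inj_on h (interior (path_image g))"
    using h interior_subset[of "path_image g"]
    by (auto simp: homeomorphism_def subset_iff intro: continuous_on_subset intro!: inj_on_inverseI[of _ g])
  then have "DIM(complex) \<le> DIM(real)"
    using invariance_of_dimension[of "interior (path_image g)" h] ne by simp
  then show False by simp
qed

text \<open>Inversion at \<open>a\<close> sends the inside without \<open>a\<close> to a connected
  unbounded set off the image curve, hence into its outside. So a nonzero point inside the image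
  curve comes from a point outside the curve, and connectedness carries the whole outside
  along.\<close>

lemma inversion_outside_subset_inside:
  fixes c :: "real \<Rightarrow> complex"
  assumes c: "simple_path c" "pathfinish c = pathstart c" and a: "a \<in> inside (path_image c)"
  defines "f \<equiv> \<lambda>z. inverse (z - a)"
  shows "f ` (inside (path_image c) - {a}) \<subseteq> outside (f ` path_image c)"
    and "f ` outside (path_image c) \<subseteq> inside (f ` path_image c)"
proof -
  let ?I = "inside (path_image c)" and ?O = "outside (path_image c)"
  note J = Jordan_inside_outside[OF c]
  \<comment> \<open>As \<open>inverse 0 = 0\<close>, the map is injective on the whole plane, with
    \<open>f a = 0\<close>.\<close>
  have injf: "inj f" by (auto simp: inj_def f_def)
  have contf: "continuous_on A f" if "a \<notin> A" for A
    using that unfolding f_def by (intro continuous_intros) auto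
  have ao: "a \<notin> ?O" "a \<notin> path_image c" using a J by blast+
  have "open ?I" "connected ?I" using J by blast+
  then have "connected (?I - {a})" by (intro connected_open_delete) auto
  then have conI: "connected (f ` (?I - {a}))" using contf by (intro connected_continuous_image) auto
  have unb: "\<not> bounded (f ` (?I - {a}))"
  proof
    assume "bounded (f ` (?I - {a}))"
    then obtain B where B: "B > 0" "\<And>z. z \<in> ?I - {a} \<Longrightarrow> norm (f z) \<le> B"
      by (auto simp: bounded_pos)
    obtain d where d: "d > 0" "ball a d \<subseteq> ?I" using \<open>open ?I\<close> a openE by blast
    \<comment> \<open>Half the radius keeps \<open>a + of_real e\<close> in the ball, and
      \<open>inverse (2 * B)\<close> makes its image at least \<open>2 * B\<close> in norm.\<close>
    define e where "e = min (d / 2) (inverse (2 * B))"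
    have e: "e > 0" "e < d" "e \<le> inverse (2 * B)" using d B by (auto simp: e_def min_def)
    have "a + of_real e \<in> ?I - {a}" using d e by (auto simp: dist_norm)
    then have "norm (f (a + of_real e)) \<le> B" by (rule B)
    then have "inverse e \<le> B" using e by (simp add: f_def norm_inverse)
    moreover have "inverse e \<ge> 2 * B"
      using e B by (metis inverse_inverse_eq le_imp_inverse_le)
    ultimately show False using B by linarith
  qed
  have disjI: "f ` (?I - {a}) \<inter> f ` path_image c = {}"
    unfolding image_Int[OF injf, symmetric] using inside_no_overlap[of "path_image c"] by blast
  show sub1: "f ` (?I - {a}) \<subseteq> outside (f ` path_image c)"
  proof
    fix y assume y: "y \<in> f ` (?I - {a})"
    have "f ` (?I - {a}) \<subseteq> connected_component_set (- f ` path_image c) y"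
      using y conI disjI by (intro connected_component_maximal) auto
    then have "\<not> bounded (connected_component_set (- f ` path_image c) y)"
      using unb bounded_subset by blast
    then show "y \<in> outside (f ` path_image c)"
      using y disjI by (auto simp: outside_def)
  qed
  have cf: "simple_path (f \<circ> c)" "pathfinish (f \<circ> c) = pathstart (f \<circ> c)"
    using c ao contf injf by (auto intro!: simple_path_continuous_image intro: inj_on_subset
        simp: pathfinish_compose pathstart_compose)
  note J' = Jordan_inside_outside[OF cf, unfolded path_image_compose]
  have "open (inside (f ` path_image c))" "inside (f ` path_image c) \<noteq> {}"
    using J' by blast+
  \<comment> \<open>The value 0 is avoided because it is the image of \<open>a\<close> and not of a
    point outside the curve.\<close>
  then have "\<not> inside (f ` path_image c) \<subseteq> {0}"
    by (metis finite.emptyI finite_insert finite_subset not_open_singleton subset_singletonD)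
  then obtain y where y: "y \<in> inside (f ` path_image c)" "y \<noteq> 0" by blast
  define z where "z = a + inverse y"
  have z: "f z = y" "z \<noteq> a" using y by (auto simp: z_def f_def)
  have "z \<in> ?O"
  proof (rule ccontr)
    assume "z \<notin> ?O"
    then have "z \<in> ?I - {a} \<or> z \<in> path_image c" using z J by blast
    then have "y \<in> outside (f ` path_image c) \<or> y \<in> f ` path_image c"
      using sub1 z by blast
    then show False using y J' by blast
  qed
  have conO: "connected (f ` ?O)"
    using J contf ao by (intro connected_continuous_image) auto
  have disjO: "f ` ?O \<inter> f ` path_image c = {}"
    unfolding image_Int[OF injf, symmetric] using outside_no_overlap[of "path_image c"] by blast
  have "f ` ?O \<subseteq> connected_component_set (- f ` path_image c) y"
    using conO disjO \<open>z \<in> ?O\<close> z by (intro connected_component_maximal) auto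
  then show "f ` ?O \<subseteq> inside (f ` path_image c)"
    using inside_same_component[OF _ y(1)] by auto
qed

context plane_drawing
begin

text \<open>The drawing is inverted at a point inside the cycle that lies on no arc and at no
  vertex, so that what was outside becomes inside. An edge bound needs every edge covered and no
  vertex counted twice.\<close>

lemma inverted_drawing:
  assumes vs: "distinct vs" "length vs \<ge> 3" "cycle_edges vs \<subseteq> E"
  obtains pos' arcs' where "plane_drawing V E pos' arcs'"
    "E \<subseteq> cycle_edges vs \<union> inner_edges (cycle_edges vs)
         \<union> plane_drawing.inner_edges E arcs' (cycle_edges vs)"
    "plane_drawing.inner_vertices V pos' arcs' (cycle_edges vs)
         \<inter> (inner_vertices (cycle_edges vs) \<union> set vs) = {}"
proof -
  let ?C = "cycle_edges vs"
  obtain c where c: "simple_path c" "pathfinish c = pathstart c" "path_image c = trace ?C"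
    using cycle_trace_curve[OF vs] .
  note J = Jordan_inside_outside[OF c(1,2), unfolded c(3)]
  \<comment> \<open>Arcs and points are closed with empty interior, and so is their finite union;
    hence the drawing does not cover the open inside of the cycle.\<close>
  have int: "closed (trace F \<union> pos ` V) \<and> interior (trace F \<union> pos ` V) = {}" if "F \<subseteq> E" for F
    using finite_subset[OF that finite_E] that
  proof (induction F rule: finite_induct)
    case empty
    then show ?case using finite_V by (simp add: trace_def finite_imp_closed empty_interior_finite)
  next
    case (insert e F)
    have eq: "trace (insert e F) \<union> pos ` V = path_image (arcs e) \<union> (trace F \<union> pos ` V)"
      by (auto simp: trace_def)
    have "arc (arcs e)" using insert arc_arcs by auto
    then show ?case unfolding eq
      using insert interior_arc_image[of "arcs e"] closed_arc_image[of "arcs e"]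
      by (simp add: interior_closed_Un_empty_interior closed_Un)
  qed
  have "\<not> inside (trace ?C) \<subseteq> trace E \<union> pos ` V"
  proof
    assume "inside (trace ?C) \<subseteq> trace E \<union> pos ` V"
    then have "inside (trace ?C) \<subseteq> interior (trace E \<union> pos ` V)" using J by (intro interior_maximal) auto
    then show False using int[of E] J by blast
  qed
  then obtain a where a: "a \<in> inside (trace ?C)" "a \<notin> trace E" "a \<notin> pos ` V" by blast
  define f where "f = (\<lambda>z. inverse (z - a))"
  have injf: "inj f" by (auto simp: inj_def f_def)
  have contf: "continuous_on A f" if "a \<notin> A" for A
    using that unfolding f_def by (intro continuous_intros) auto
  define pos' where "pos' = f \<circ> pos"
  define arcs' where "arcs' = (\<lambda>e. f \<circ> arcs e)"
  have im: "path_image (arcs' e) = f ` path_image (arcs e)" for e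
    by (simp add: arcs'_def path_image_compose)
  have pim: "pos' ` A = f ` pos ` A" for A by (simp add: pos'_def image_comp)
  have draw: "plane_drawing V E pos' arcs'"
  proof
    show "simple_graph V E" by (rule graph)
    show "inj_on pos' V" unfolding pos'_def using inj_pos injf by (auto intro: comp_inj_on inj_on_subset)
    fix e assume e: "e \<in> E"
    have "a \<notin> path_image (arcs e)" using a e by (auto simp: trace_def)
    then have "simple_path (arcs' e)" unfolding arcs'_def
      using e arc_arcs contf injf
      by (intro simple_path_continuous_image) (auto intro: inj_on_subset arc_imp_simple_path)
    moreover have "pathfinish (arcs' e) \<noteq> pathstart (arcs' e)"
      using arc_distinct_ends[OF arc_arcs[OF e]] injf
      by (auto simp: arcs'_def pathfinish_compose pathstart_compose inj_def)
    ultimately show "arc (arcs' e)" by (simp add: arc_simple_path)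
    show "{pathstart (arcs' e), pathfinish (arcs' e)} = pos' ` e"
      unfolding pim arc_ends[OF e, symmetric]
      by (simp add: arcs'_def pathfinish_compose pathstart_compose)
    show "path_image (arcs' e) \<inter> pos' ` V = pos' ` e"
      unfolding pim im image_Int[OF injf, symmetric] arc_vertices[OF e] ..
    fix e' assume e': "e' \<in> E" "e \<noteq> e'"
    show "path_image (arcs' e) \<inter> path_image (arcs' e') \<subseteq> pos' ` (e \<inter> e')"
      unfolding pim im image_Int[OF injf, symmetric] using arcs_meet[OF e e'] by (rule image_mono)
  qed
  interpret D: plane_drawing V E pos' arcs' by (rule draw)
  have tr: "D.trace F = f ` trace F" for F by (auto simp: D.trace_def trace_def im)
  have mid': "D.mid e = f (mid e)" for e by (simp add: D.mid_def mid_def) (simp add: arcs'_def)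
  note inv = inversion_outside_subset_inside[OF c(1,2), unfolded c(3), OF a(1), folded f_def]
  have "e \<in> ?C \<union> inner_edges ?C \<union> D.inner_edges ?C" if e: "e \<in> E" for e
  proof (cases "e \<in> ?C \<union> inner_edges ?C")
    case False
    then have "mid e \<in> outside (trace ?C)"
      using e mid_in_trace_iff[OF e vs(3)] union_with_inside[of "trace ?C"] by (auto simp: inner_edges_def)
    then show ?thesis using inv(2) e by (auto simp: D.inner_edges_def mid' tr)
  qed auto
  moreover have "v \<notin> D.inner_vertices ?C" if v: "v \<in> inner_vertices ?C \<union> set vs" for v
  proof
    assume D: "v \<in> D.inner_vertices ?C"
    then have vV: "v \<in> V" and iv: "f (pos v) \<in> inside (f ` trace ?C)"
      unfolding D.inner_vertices_def tr by (simp_all add: pos'_def)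
    have UC: "\<Union>?C = set vs" using vs by (intro Union_cycle_edges) auto
    show False
    proof (cases "v \<in> set vs")
      case True
      then have "pos v \<in> trace ?C" using pos_in_trace_iff[OF vV vs(3)] UC by simp
      then show False using iv inside_no_overlap[of "f ` trace ?C"] by blast
    next
      case False
      then have "pos v \<in> inside (trace ?C) - {a}" using v a vV by (auto simp: inner_vertices_def)
      then have "f (pos v) \<in> outside (f ` trace ?C)" using inv(1) by blast
      then show False using iv inside_Int_outside[of "f ` trace ?C"] by blast
    qed
  qed
  ultimately show thesis using that[OF draw] by blast
qed

end

section \<open>The edge count by induction on the number of vertices\<close>

lemma planar_mono:
  fixes V :: "'a set"
  assumes "planar V E" "V' \<subseteq> V" "E' \<subseteq> E" "\<And>e. e \<in> E' \<Longrightarrow> e \<subseteq> V'"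
  shows "planar V' E'"
proof -
  obtain pos :: "'a \<Rightarrow> complex" and arcs where inj: "inj_on pos V"
    and ends: "\<forall>e\<in>E. arc (arcs e) \<and> {pathstart (arcs e), pathfinish (arcs e)} = pos ` e \<and>
                path_image (arcs e) \<inter> pos ` V = pos ` e"
    and meet: "\<forall>e\<in>E. \<forall>e'\<in>E. e \<noteq> e' \<longrightarrow>
                path_image (arcs e) \<inter> path_image (arcs e') \<subseteq> pos ` (e \<inter> e')"
    using assms(1) unfolding planar_def by blast
  have "path_image (arcs e) \<inter> pos ` V' = pos ` e" if "e \<in> E'" for e
    using bspec[OF ends, of e] assms that by blast
  then show ?thesis
    unfolding planar_def using inj_on_subset[OF inj assms(2)] bspec[OF ends] bspec[OF bspec[OF meet]]
      subsetD[OF assms(3)]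
    by (intro exI[of _ pos] exI[of _ arcs] conjI ballI impI) simp_all
qed

lemma planar_imp_plane_drawing:
  fixes V :: "'a set"
  assumes "planar V E" "simple_graph V E"
  obtains pos arcs where "plane_drawing V E pos arcs"
proof -
  obtain pos :: "'a \<Rightarrow> complex" and arcs where inj: "inj_on pos V"
    and ends: "\<forall>e\<in>E. arc (arcs e) \<and> {pathstart (arcs e), pathfinish (arcs e)} = pos ` e \<and>
                path_image (arcs e) \<inter> pos ` V = pos ` e"
    and meet: "\<forall>e\<in>E. \<forall>e'\<in>E. e \<noteq> e' \<longrightarrow>
                path_image (arcs e) \<inter> path_image (arcs e') \<subseteq> pos ` (e \<inter> e')"
    using assms(1) unfolding planar_def by blast
  have "plane_drawing V E pos arcs"
    by unfold_locales (use assms(2) inj bspec[OF ends] bspec[OF bspec[OF meet]] in simp_all)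
  then show thesis by (rule that)
qed

text \<open>A vertex of degree at most 2 is deleted. Otherwise there is a cycle, and the inside
  bounds for a drawing and for its inversion account for all edges. The constant is weaker than in 2
  N - 4, so that a single edge on two vertices is allowed and starts the induction.\<close>

theorem planar_triangle_free_card_edges:
  assumes "planar V E" "simple_graph V E" "card V \<ge> 2"
    and "\<And>vs. distinct vs \<Longrightarrow> length vs = 3 \<Longrightarrow> \<not> cycle_edges vs \<subseteq> E"
  shows "card E + 2 \<le> 2 * card V"
  using assms
proof (induction "card V" arbitrary: V E rule: less_induct)
  case less
  note pl = less.prems(1) and sg = less.prems(2) and tri = less.prems(4)
  have finV: "finite V" and sub: "\<And>e. e \<in> E \<Longrightarrow> e \<subseteq> V" and two: "\<And>e. e \<in> E \<Longrightarrow> card e = 2"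
    using sg by (auto simp: simple_graph_def)
  have finE: "finite E" using finite_subset[of E "Pow V"] finV sub by auto
  have sparse: "card {e \<in> E. e \<subseteq> X} + 2 \<le> 2 * card X" if X: "X \<subset> V" "card X \<ge> 2" for X
  proof (rule less.hyps)
    show "card X < card V" using X finV by (simp add: psubset_card_mono)
    show "planar X {e \<in> E. e \<subseteq> X}" using pl X by (auto intro: planar_mono)
    show "simple_graph X {e \<in> E. e \<subseteq> X}"
      using sg X by (auto simp: simple_graph_def intro: finite_subset)
    show "card X \<ge> 2" by (rule X)
    show "\<not> cycle_edges vs \<subseteq> {e \<in> E. e \<subseteq> X}" if "distinct vs" "length vs = 3" for vs
      using tri[OF that] by blast
  qed
  show ?case
  proof (cases "\<exists>v\<in>V. card {e \<in> E. v \<in> e} \<le> 2")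
    case True
    then obtain v where v: "v \<in> V" "card {e \<in> E. v \<in> e} \<le> 2" by blast
    show ?thesis
    proof (cases "card V = 2")
      case True
      have "e = V" if "e \<in> E" for e
        using sub[OF that] two[OF that] True finV by (metis card_subset_eq)
      then have "E \<subseteq> {V}" by blast
      then have "card E \<le> card {V}" by (intro card_mono) auto
      then show ?thesis using True by simp
    next
      case False
      have cX: "card (V - {v}) = card V - 1" using v finV by simp
      have "card {e \<in> E. e \<subseteq> V - {v}} + 2 \<le> 2 * card (V - {v})"
        using v False less.prems(3) cX by (intro sparse) auto
      moreover have "card E \<le> card ({e \<in> E. e \<subseteq> V - {v}} \<union> {e \<in> E. v \<in> e})"
        using finE sub by (intro card_mono) auto
      moreover have "\<dots> \<le> card {e \<in> E. e \<subseteq> V - {v}} + card {e \<in> E. v \<in> e}" by (rule card_Un_le)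
      ultimately show ?thesis using v(2) cX less.prems(3) by linarith
    qed
  next
    case False
    then have deg: "2 \<le> card {e \<in> E. v \<in> e}" if "v \<in> V" for v using that by fastforce
    have "V \<noteq> {}" using less.prems(3) by auto
    obtain vs where vs: "distinct vs" "length vs \<ge> 3" "cycle_edges vs \<subseteq> E"
      using ex_cycle[OF finV \<open>V \<noteq> {}\<close> sub two deg] by blast
    let ?C = "cycle_edges vs"
    obtain pos arcs where "plane_drawing V E pos arcs"
      using planar_imp_plane_drawing[OF pl sg] .
    then interpret A: plane_drawing V E pos arcs .
    obtain pos' arcs' where "plane_drawing V E pos' arcs'"
      and E: "E \<subseteq> ?C \<union> A.inner_edges ?C \<union> plane_drawing.inner_edges E arcs' ?C"
      and W: "plane_drawing.inner_vertices V pos' arcs' ?C \<inter> (A.inner_vertices ?C \<union> set vs) = {}"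
      using A.inverted_drawing[OF vs] .
    then interpret B: plane_drawing V E pos' arcs' by simp
    have fin: "finite (A.inner_edges ?C)" "finite (B.inner_edges ?C)"
      "finite (A.inner_vertices ?C)" "finite (B.inner_vertices ?C)"
      using finE finV by (auto simp: A.inner_edges_def B.inner_edges_def
          A.inner_vertices_def B.inner_vertices_def)
    have "card E \<le> card (?C \<union> A.inner_edges ?C \<union> B.inner_edges ?C)"
      using E fin finite_cycle_edges by (intro card_mono) auto
    also have "\<dots> \<le> card ?C + card (A.inner_edges ?C) + card (B.inner_edges ?C)"
      by (meson add_le_mono card_Un_le le_refl order_trans)
    finally have e: "card E \<le> length vs + card (A.inner_edges ?C) + card (B.inner_edges ?C)"
      using card_cycle_edges[of vs] by linarith
    have UC: "\<Union>?C = set vs" using vs by (intro Union_cycle_edges) auto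
    have sV: "set vs \<subseteq> V" using UC vs(3) sub by blast
    have "A.inner_vertices ?C \<inter> set vs = {}"
    proof (rule ccontr)
      assume "A.inner_vertices ?C \<inter> set vs \<noteq> {}"
      then obtain v where "v \<in> V" "pos v \<in> inside (A.trace ?C)" "v \<in> \<Union>?C"
        using UC by (auto simp: A.inner_vertices_def)
      then show False
        using A.pos_in_trace_iff[OF _ vs(3)] inside_no_overlap[of "A.trace ?C"] by blast
    qed
    then have "card (B.inner_vertices ?C) + (card (A.inner_vertices ?C) + length vs)
        = card (B.inner_vertices ?C) + card (A.inner_vertices ?C \<union> set vs)"
      using fin distinct_card[OF vs(1)] by (simp add: card_Un_disjoint)
    also have "\<dots> = card (B.inner_vertices ?C \<union> (A.inner_vertices ?C \<union> set vs))"
      using W fin by (intro card_Un_disjoint[symmetric]) auto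
    also have "\<dots> \<le> card V"
      using finV sV by (intro card_mono) (auto simp: A.inner_vertices_def B.inner_vertices_def)
    \<comment> \<open>With i and j vertices on the two sides of the cycle of length c, twice the
      number of edges is at most 2 c + (4 i + c - 4) + (4 j + c - 4), which is at most
      \<open>4 * card V - 8\<close>.\<close>
    finally show ?thesis
      using e A.inside_bound[OF tri sparse vs] B.inside_bound[OF tri sparse vs] by linarith
  qed
qed

section \<open>Planarity of a layer\<close>

text \<open>The hull of the two end positions is the segment between them, described without
  choosing a direction for the edge.\<close>

lemma planar_straight_line:
  fixes pos :: "'a \<Rightarrow> complex"
  assumes two: "\<And>e. e \<in> E \<Longrightarrow> e \<subseteq> V \<and> card e = 2" and inj: "inj_on pos V"
    and vert: "\<And>e. e \<in> E \<Longrightarrow> convex hull (pos ` e) \<inter> pos ` V \<subseteq> pos ` e"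
    and cross: "\<And>e e'. e \<in> E \<Longrightarrow> e' \<in> E \<Longrightarrow> e \<noteq> e' \<Longrightarrow>
        convex hull (pos ` e) \<inter> convex hull (pos ` e') \<subseteq> pos ` e \<inter> pos ` e'"
  shows "planar V E"
proof -
  have "\<forall>e\<in>E. \<exists>u v. e = {u, v} \<and> u \<noteq> v" using two by (meson card_2_iff)
  then obtain s t where st: "\<And>e. e \<in> E \<Longrightarrow> e = {s e, t e}" "\<And>e. e \<in> E \<Longrightarrow> s e \<noteq> t e"
    by metis
  define arcs where "arcs e = linepath (pos (s e)) (pos (t e))" for e
  have pe: "pos ` e = {pos (s e), pos (t e)}" if "e \<in> E" for e
    using arg_cong[OF st(1)[OF that], of "image pos"] by simp
  have im: "path_image (arcs e) = convex hull (pos ` e)" if "e \<in> E" for e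
    unfolding pe[OF that] arcs_def by (simp add: segment_convex_hull)
  have ne: "pos (s e) \<noteq> pos (t e)" if "e \<in> E" for e
  proof -
    have "s e \<in> V" "t e \<in> V" using two[OF that] st(1)[OF that] by blast+
    then show ?thesis using inj_onD[OF inj] st(2)[OF that] by blast
  qed
  have "path_image (arcs e) \<inter> pos ` V = pos ` e" if "e \<in> E" for e
    using vert[OF that] two[OF that] hull_subset[of "pos ` e" convex] im[OF that] by blast
  moreover have "path_image (arcs e) \<inter> path_image (arcs e') \<subseteq> pos ` (e \<inter> e')"
    if "e \<in> E" "e' \<in> E" "e \<noteq> e'" for e e'
    using cross[OF that] two[OF that(1)] two[OF that(2)] inj_on_image_Int[OF inj, of e e'] im that by simp
  moreover have "arc (arcs e)" "{pathstart (arcs e), pathfinish (arcs e)} = pos ` e" if "e \<in> E" for e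
    using ne[OF that] pe[OF that] by (simp_all add: arcs_def)
  ultimately show ?thesis
    unfolding planar_def using inj
    by (intro exI[of _ pos] exI[of _ arcs] conjI ballI impI) simp_all
qed

text \<open>The drawing of a layer has fourfold rotational symmetry: the cube is drawn as two concentric
  squares joined by four spokes, and in each of the four trapezoids between the squares arbitrarily
  many vertices, placed on one diagonal, are joined to the two corners off that diagonal.
  A piece is an open edge or a vertex in the sector of arguments \<open>[0, \<pi>/2)\<close>; the predicate \<open>cell\<close>
  describes the points that it consists of.\<close>

datatype piece = Spoke | Inner | Outer | Low real | High real
  | Inner_Vertex | Outer_Vertex | Mid_Vertex real

fun cell :: "piece \<Rightarrow> real \<Rightarrow> real \<Rightarrow> bool" where
  "cell Spoke x y \<longleftrightarrow> y = 0 \<and> 1 < x \<and> x < 2"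
| "cell Inner x y \<longleftrightarrow> 0 < y \<and> x + y = 1"
| "cell Outer x y \<longleftrightarrow> 0 < y \<and> x + y = 2"
| "cell (Low t) x y \<longleftrightarrow> 0 < y \<and> 1 < x + y \<and> x + 2 * y < 2 \<and> t * (x + 2 * y - 1) = x + y - 1"
| "cell (High t) x y \<longleftrightarrow> 0 < y \<and> x + y < 2 \<and> 2 < x + 2 * y \<and> t * (4 - 2 * y - x) = x"
| "cell Inner_Vertex x y \<longleftrightarrow> x = 1 \<and> y = 0"
| "cell Outer_Vertex x y \<longleftrightarrow> x = 2 \<and> y = 0"
| "cell (Mid_Vertex t) x y \<longleftrightarrow> 0 < y \<and> x = 2 * t \<and> y = 1 - t"

fun edge_piece :: "piece \<Rightarrow> bool" where
  "edge_piece Spoke \<longleftrightarrow> True"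
| "edge_piece Inner \<longleftrightarrow> True"
| "edge_piece Outer \<longleftrightarrow> True"
| "edge_piece (Low t) \<longleftrightarrow> 0 < t \<and> t < 1"
| "edge_piece (High t) \<longleftrightarrow> 0 < t \<and> t < 1"
| "edge_piece _ \<longleftrightarrow> False"

fun vertex_piece :: "piece \<Rightarrow> bool" where
  "vertex_piece Inner_Vertex \<longleftrightarrow> True"
| "vertex_piece Outer_Vertex \<longleftrightarrow> True"
| "vertex_piece (Mid_Vertex t) \<longleftrightarrow> 0 < t \<and> t < 1"
| "vertex_piece _ \<longleftrightarrow> False"

definition rot :: "nat \<Rightarrow> real \<Rightarrow> real \<Rightarrow> complex" where
  "rot k x y = \<i> ^ k * Complex x y"

text \<open>The quadrant includes the positive real axis but not the imaginary one; its four quarter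
  turns tile the plane without the origin, so that no point has two descriptions.\<close>

definition cell_set :: "nat \<Rightarrow> piece \<Rightarrow> complex set" where
  "cell_set k p = {rot k x y | x y. 0 < x \<and> 0 \<le> y \<and> cell p x y}"

fun vertex_point :: "nat \<times> piece \<Rightarrow> complex" where
  "vertex_point (k, Inner_Vertex) = rot k 1 0"
| "vertex_point (k, Outer_Vertex) = rot k 2 0"
| "vertex_point (k, Mid_Vertex t) = rot k (2 * t) (1 - t)"
| "vertex_point _ = 0"

text \<open>A corner on the positive imaginary axis of a sector belongs to the next one, whence
  \<open>Suc k mod 4\<close>. \<open>Low\<close> and \<open>High\<close> edges lead from a middle
  vertex to the two corners off the diagonal that carries it.\<close>

fun piece_ends :: "nat \<Rightarrow> piece \<Rightarrow> (nat \<times> piece) set" where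
  "piece_ends k Spoke = {(k, Inner_Vertex), (k, Outer_Vertex)}"
| "piece_ends k Inner = {(k, Inner_Vertex), (Suc k mod 4, Inner_Vertex)}"
| "piece_ends k Outer = {(k, Outer_Vertex), (Suc k mod 4, Outer_Vertex)}"
| "piece_ends k (Low t) = {(k, Inner_Vertex), (k, Mid_Vertex t)}"
| "piece_ends k (High t) = {(Suc k mod 4, Outer_Vertex), (k, Mid_Vertex t)}"
| "piece_ends _ _ = {}"

section \<open>Disjointness of the cells\<close>

lemma rot_in_cell_setI: "0 < x \<Longrightarrow> 0 \<le> y \<Longrightarrow> cell p x y \<Longrightarrow> rot k x y \<in> cell_set k p"
  by (auto simp: cell_set_def)

text \<open>The line x + 2 y = 2 carries the middle vertices and separates \<open>Low\<close> from
  \<open>High\<close> edges; within either kind \<open>t\<close> is a quotient with nonzero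
  denominator.\<close>

lemma cell_unique:
  assumes "cell p x y" "cell q x y" "0 < x"
  shows "p = q"
proof -
  have low: "t = t'" if "t * (x + 2 * y - 1) = x + y - 1" "t' * (x + 2 * y - 1) = x + y - 1"
    "1 < x + y" "0 < y" for t t'
  proof -
    have "x + 2 * y - 1 > 0" using that by linarith
    then show ?thesis using that(1,2) by (metis less_irrefl mult_right_cancel)
  qed
  have high: "t = t'" if "t * (4 - 2 * y - x) = x" "t' * (4 - 2 * y - x) = x" for t t'
    using that assms(3) by (metis less_irrefl mult_right_cancel mult_zero_right)
  show ?thesis
    using assms by (cases p; cases q) (auto intro: low high)
qed

lemma rot_eq_iff:
  assumes "k < 4" "k' < 4" "0 < x" "0 \<le> y" "0 < x'" "0 \<le> y'"
  shows "rot k x y = rot k' x' y' \<longleftrightarrow> k = k' \<and> x = x' \<and> y = y'"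
proof -
  have "k \<in> {0, 1, 2, 3}" "k' \<in> {0, 1, 2, 3}" using assms by auto
  then show ?thesis
    using assms by (auto simp: rot_def complex_eq_iff power3_eq_cube)
qed

text \<open>Edges without their ends, and vertices, are pairwise disjoint in the drawing; this takes
  the place of comparing segments two by two.\<close>

lemma cell_set_unique:
  assumes "z \<in> cell_set k p" "z \<in> cell_set k' p'" "k < 4" "k' < 4"
  shows "k = k' \<and> p = p'"
proof -
  obtain x y where z: "z = rot k x y" "0 < x" "0 \<le> y" "cell p x y"
    using assms by (auto simp: cell_set_def)
  obtain x' y' where z': "z = rot k' x' y'" "0 < x'" "0 \<le> y'" "cell p' x' y'"
    using assms by (auto simp: cell_set_def)
  have "k = k' \<and> x = x' \<and> y = y'"
    using rot_eq_iff[of k k' x y x' y'] assms(3,4) z z' by simp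
  then show ?thesis using cell_unique z z' by blast
qed

lemma vertex_point_in_cell_set: "vertex_piece p \<Longrightarrow> vertex_point (k, p) \<in> cell_set k p"
  by (cases p) (auto simp: cell_set_def)

lemma vertex_piece_not_edge_piece: "vertex_piece p \<Longrightarrow> \<not> edge_piece p"
  by (cases p) auto

text \<open>The axis between two consecutive sectors, seen from either side; the last sector is
  followed by the first because the fourth power of \<open>\<i>\<close> is 1.\<close>

lemma rot_Suc_mod: "rot (Suc k mod 4) x 0 = rot k 0 x"
proof -
  have "\<i> ^ (4 * (Suc k div 4) + Suc k mod 4) = (\<i> ^ 4) ^ (Suc k div 4) * \<i> ^ (Suc k mod 4)"
    by (simp only: power_add power_mult)
  then have "\<i> ^ (Suc k mod 4) = \<i> ^ Suc k" by (simp add: power4_eq_xxxx)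
  then show ?thesis by (simp add: rot_def complex_eq_iff)
qed

lemma rot_segment:
  assumes "z \<in> convex hull {rot k x y, rot k x' y'}"
  obtains "z \<in> {rot k x y, rot k x' y'}"
  | s where "0 < s" "s < 1" "z = rot k ((1 - s) * x + s * x') ((1 - s) * y + s * y')"
proof -
  obtain s where s: "0 \<le> s" "s \<le> 1" "z = (1 - s) *\<^sub>R rot k x y + s *\<^sub>R rot k x' y'"
    using assms by (auto simp: segment_convex_hull[symmetric] in_segment)
  have "z = rot k ((1 - s) * x + s * x') ((1 - s) * y + s * y')"
  proof -
    have "Complex ((1 - s) * x + s * x') ((1 - s) * y + s * y')
        = (1 - s) *\<^sub>R Complex x y + s *\<^sub>R Complex x' y'" by (simp add: complex_eq_iff)
    then show ?thesis unfolding s(3) rot_def by (simp add: distrib_left)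
  qed
  moreover have "s = 0 \<or> s = 1 \<or> (0 < s \<and> s < 1)" using s by auto
  ultimately show thesis using that by auto
qed

lemma hull_piece_ends:
  assumes "edge_piece p"
  shows "convex hull (vertex_point ` piece_ends k p) \<subseteq> vertex_point ` piece_ends k p \<union> cell_set k p"
proof
  fix z assume z: "z \<in> convex hull (vertex_point ` piece_ends k p)"
  show "z \<in> vertex_point ` piece_ends k p \<union> cell_set k p"
  proof (cases p)
    case Spoke
    have "z \<in> convex hull {rot k 1 0, rot k 2 0}" using z Spoke by (simp add: rot_Suc_mod)
    then show ?thesis
    proof (rule rot_segment)
      fix s :: real
      assume s: "0 < s" "s < 1" and zs: "z = rot k ((1 - s) * 1 + s * 2) ((1 - s) * 0 + s * 0)"
      show ?thesis unfolding zs by (intro UnI2 rot_in_cell_setI) (use s in \<open>auto simp: Spoke\<close>)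
    qed (auto simp: Spoke rot_Suc_mod)
  next
    case Inner
    have "z \<in> convex hull {rot k 1 0, rot k 0 1}" using z Inner by (simp add: rot_Suc_mod)
    then show ?thesis
    proof (rule rot_segment)
      fix s :: real
      assume s: "0 < s" "s < 1" and zs: "z = rot k ((1 - s) * 1 + s * 0) ((1 - s) * 0 + s * 1)"
      show ?thesis unfolding zs by (intro UnI2 rot_in_cell_setI) (use s in \<open>auto simp: Inner\<close>)
    qed (auto simp: Inner rot_Suc_mod)
  next
    case Outer
    have "z \<in> convex hull {rot k 2 0, rot k 0 2}" using z Outer by (simp add: rot_Suc_mod)
    then show ?thesis
    proof (rule rot_segment)
      fix s :: real
      assume s: "0 < s" "s < 1" and zs: "z = rot k ((1 - s) * 2 + s * 0) ((1 - s) * 0 + s * 2)"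
      show ?thesis unfolding zs by (intro UnI2 rot_in_cell_setI) (use s in \<open>auto simp: Outer\<close>)
    qed (auto simp: Outer rot_Suc_mod)
  next
    case (Low t)
    then have t: "0 < t" "t < 1" using assms by auto
    have "z \<in> convex hull {rot k 1 0, rot k (2 * t) (1 - t)}" using z Low by (simp add: rot_Suc_mod)
    then show ?thesis
    proof (rule rot_segment)
      fix s :: real
      assume s: "0 < s" "s < 1" and zs: "z = rot k ((1 - s) * 1 + s * (2 * t)) ((1 - s) * 0 + s * (1 - t))"
      \<comment> \<open>The point satisfies \<open>x + 2 * y - 1 = s\<close> and
        \<open>x + y - 1 = s * t\<close>, which is where the equation of \<open>Low t\<close> comes
        from.\<close>
      define w where "w = s * t"
      have w: "0 < w" "w < s" "t * s = w" using s t by (auto simp: w_def)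
      have zw: "z = rot k (1 - s + 2 * w) (s - w)" unfolding zs w_def by (simp add: algebra_simps)
      have "1 - s + 2 * w + 2 * (s - w) - 1 = s" by simp
      then have "cell p (1 - s + 2 * w) (s - w)" unfolding Low cell.simps using s w by simp
      then show ?thesis unfolding zw using s w by (intro UnI2 rot_in_cell_setI) auto
    qed (auto simp: Low rot_Suc_mod)
  next
    case (High t)
    then have t: "0 < t" "t < 1" using assms by auto
    have "z \<in> convex hull {rot k 0 2, rot k (2 * t) (1 - t)}" using z High by (simp add: rot_Suc_mod)
    then show ?thesis
    proof (rule rot_segment)
      fix s :: real
      assume s: "0 < s" "s < 1" and zs: "z = rot k ((1 - s) * 0 + s * (2 * t)) ((1 - s) * 2 + s * (1 - t))"
      \<comment> \<open>Here \<open>4 - 2 * y - x = 2 * s\<close> and \<open>x = 2 * s * t\<close>,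
        whence the equation of \<open>High t\<close>.\<close>
      define w where "w = s * t"
      have w: "0 < w" "w < s" "t * s = w" using s t by (auto simp: w_def)
      have zw: "z = rot k (2 * w) (2 - s - w)" unfolding zs w_def by (simp add: algebra_simps)
      have "4 - 2 * (2 - s - w) - 2 * w = 2 * s" by simp
      then have "cell p (2 * w) (2 - s - w)" unfolding High cell.simps using s w by simp
      then show ?thesis unfolding zw using s w by (intro UnI2 rot_in_cell_setI) auto
    qed (auto simp: High rot_Suc_mod)
  qed (use assms in auto)
qed

text \<open>Reduces planarity to a labelling: distinct edges receive distinct pieces, and
  disjointness of the cells rules out crossings.\<close>

lemma planar_coded:
  fixes code :: "'a \<Rightarrow> nat \<times> piece"
  assumes two: "\<And>e. e \<in> E \<Longrightarrow> e \<subseteq> V \<and> card e = 2" and inj: "inj_on code V"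
    and vert: "\<And>v. v \<in> V \<Longrightarrow> fst (code v) < 4 \<and> vertex_piece (snd (code v))"
    and edge: "\<And>e. e \<in> E \<Longrightarrow> \<exists>k p. k < 4 \<and> edge_piece p \<and> code ` e = piece_ends k p"
  shows "planar V E"
proof (rule planar_straight_line[where pos = "vertex_point \<circ> code"])
  have vc: "(vertex_point \<circ> code) v \<in> cell_set (fst (code v)) (snd (code v))" if "v \<in> V" for v
    using vertex_point_in_cell_set[of "snd (code v)" "fst (code v)"] vert[OF that] by simp
  obtain K P where KP: "\<And>e. e \<in> E \<Longrightarrow> K e < 4 \<and> edge_piece (P e) \<and> code ` e = piece_ends (K e) (P e)"
    using edge by metis
  have hull: "convex hull ((vertex_point \<circ> code) ` e) \<subseteq> (vertex_point \<circ> code) ` e \<union> cell_set (K e) (P e)"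
    if "e \<in> E" for e
    using hull_piece_ends[of "P e" "K e"] KP[OF that] by (metis image_comp)
  have off: "(vertex_point \<circ> code) v \<notin> cell_set (K e) (P e)" if "v \<in> V" "e \<in> E" for v e
    using cell_set_unique[OF vc[OF that(1)], of "K e" "P e"] vert[OF that(1)] KP[OF that(2)]
      vertex_piece_not_edge_piece by metis
  show "e \<subseteq> V \<and> card e = 2" if "e \<in> E" for e by (rule two[OF that])
  show "inj_on (vertex_point \<circ> code) V"
  proof (rule inj_onI)
    fix v w assume vw: "v \<in> V" "w \<in> V" "(vertex_point \<circ> code) v = (vertex_point \<circ> code) w"
    have "code v = code w"
      using cell_set_unique[OF vc[OF vw(1)], of "fst (code w)" "snd (code w)"] vc[OF vw(2)] vert vw
      by (simp add: prod_eq_iff)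
    then show "v = w" using inj vw by (auto dest: inj_onD)
  qed
  show "convex hull ((vertex_point \<circ> code) ` e) \<inter> (vertex_point \<circ> code) ` V \<subseteq> (vertex_point \<circ> code) ` e"
    if "e \<in> E" for e
    using hull[OF that] off[OF _ that] by blast
  show "convex hull ((vertex_point \<circ> code) ` e) \<inter> convex hull ((vertex_point \<circ> code) ` e')
      \<subseteq> (vertex_point \<circ> code) ` e \<inter> (vertex_point \<circ> code) ` e'"
    if e: "e \<in> E" "e' \<in> E" "e \<noteq> e'" for e e'
  proof -
    have "code ` e \<noteq> code ` e'"
      using inj_on_image_eq_iff[OF inj, of e e'] two e by blast
    then have "K e \<noteq> K e' \<or> P e \<noteq> P e'" using KP[OF e(1)] KP[OF e(2)] by auto
    then have "cell_set (K e) (P e) \<inter> cell_set (K e') (P e') = {}"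
      using cell_set_unique KP[OF e(1)] KP[OF e(2)] by blast
    moreover have "(vertex_point \<circ> code) ` e \<inter> cell_set (K e') (P e') = {}"
      "(vertex_point \<circ> code) ` e' \<inter> cell_set (K e) (P e) = {}"
      using off two e by blast+
    moreover have "A \<inter> B \<subseteq> a \<inter> b"
      if "A \<subseteq> a \<union> c" "B \<subseteq> b \<union> d" "c \<inter> d = {}" "a \<inter> d = {}" "b \<inter> c = {}"
      for A B a b c d :: "complex set"
      using that by blast
    ultimately show ?thesis using hull[OF e(1)] hull[OF e(2)] by metis
  qed
qed

section \<open>The product of K_n and K_2 as a bipartite graph\<close>

lemma kron_complete_K2:
  fixes n :: nat
  shows
  "kron_edges (complete_edges {0..<n}) (complete_edges {0..<2::nat})
     = {{(u, 0), (v, 1)} | u v. u < n \<and> v < n \<and> u \<noteq> v}" (is "?L = ?R")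
proof
  show "?L \<subseteq> ?R"
  proof
    fix e assume "e \<in> ?L"
    then obtain g h g' h' where e: "e = {(g, h), (g', h')}"
      and g: "{g, g'} \<in> complete_edges {0..<n}" and h: "{h, h'} \<in> complete_edges {0..<2::nat}"
      by (auto simp: kron_edges_def)
    have "g < n" "g' < n" "g \<noteq> g'" using g by (auto simp: complete_edges_def doubleton_eq_iff)
    moreover have "h = 0 \<and> h' = 1 \<or> h = 1 \<and> h' = 0"
      using h by (auto simp: complete_edges_def doubleton_eq_iff)
    ultimately show "e \<in> ?R" unfolding e by (auto simp: insert_commute)
  qed
  show "?R \<subseteq> ?L"
  proof clarify
    fix u v :: nat assume "u < n" "v < n" "u \<noteq> v"
    then have "{u, v} \<in> complete_edges {0..<n}" by (auto simp: complete_edges_def)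
    moreover have "{0, 1} \<in> complete_edges {0..<2::nat}"
      unfolding complete_edges_def by (intro CollectI exI[of _ 0] exI[of _ 1]) simp
    ultimately show "{(u, 0), (v, 1)} \<in> ?L" by (auto simp: kron_edges_def)
  qed
qed

lemma card_kron_complete_K2:
  fixes n :: nat
  shows
  "card (kron_edges (complete_edges {0..<n}) (complete_edges {0..<2::nat})) = n * (n - 1)"
proof -
  let ?S = "{0..<n} \<times> {0..<n} - (\<lambda>u. (u, u)) ` {0..<n}"
  let ?f = "\<lambda>(u, v). {(u, 0::nat), (v, 1)}"
  have "kron_edges (complete_edges {0..<n}) (complete_edges {0..<2::nat}) = ?f ` ?S"
    unfolding kron_complete_K2 by (auto simp: image_iff) blast
  moreover have "inj_on ?f ?S" by (auto simp: inj_on_def doubleton_eq_iff)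
  ultimately have "card (kron_edges (complete_edges {0..<n}) (complete_edges {0..<2::nat})) = card ?S"
    by (simp add: card_image)
  also have "\<dots> = card ({0..<n} \<times> {0..<n}) - card ((\<lambda>u. (u, u)) ` {0..<n})"
    by (intro card_Diff_subset) auto
  also have "\<dots> = n * (n - 1)"
    by (simp add: card_image inj_on_def diff_mult_distrib2)
  finally show ?thesis .
qed

lemma bipartite_no_triangle:
  assumes "\<And>e. e \<in> E \<Longrightarrow> \<exists>x y. e = {x, y} \<and> c x \<noteq> (c y :: bool)" "length vs = 3"
  shows "\<not> cycle_edges vs \<subseteq> E"
proof
  assume sub: "cycle_edges vs \<subseteq> E"
  obtain x y z where vs: "vs = [x, y, z]"
    using assms(2) by (auto simp: length_Suc_conv numeral_3_eq_3)
  have "c u \<noteq> c v" if "{u, v} \<in> E" for u v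
    using assms(1)[OF that] by (auto simp: doubleton_eq_iff)
  then have "c x \<noteq> c y" "c y \<noteq> c z" "c z \<noteq> c x" using sub by (auto simp: vs cycle_edges_def)
  then show False by blast
qed

text \<open>The two copies of a vertex sit at antipodal corners of the cube, the only corners of
  opposite colour that are not adjacent. Level 0 takes the outer corners of even and the inner
  corners of odd sectors, a colour class of the cube.\<close>

fun core_code :: "nat \<Rightarrow> nat \<Rightarrow> nat \<times> piece" where
  "core_code a s =
    (if s = 0 then [(2, Outer_Vertex), (1, Inner_Vertex), (3, Inner_Vertex), (0, Outer_Vertex)] ! a
     else [(0, Inner_Vertex), (3, Outer_Vertex), (1, Outer_Vertex), (2, Inner_Vertex)] ! a)"

text \<open>Vertices off the core go to face 0 or 2 from level 0 and to face 1 or 3 from level 1, so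
  that the corners they are joined to are on the other level. The parameter lies strictly between 0
  and 1 and separates vertices in the same face.\<close>

fun layer_code :: "nat \<Rightarrow> nat \<times> nat \<Rightarrow> nat \<times> piece" where
  "layer_code r (x, s) =
    (if x div 4 = r then core_code (x mod 4) s
     else (if s = 0 then if x mod 4 < 2 then 0 else 2 else if odd x then 1 else 3,
           Mid_Vertex (1 / (real x + 2))))"

text \<open>An edge goes to the block of one of its ends, chosen so that in layer \<open>r\<close> each vertex outside
  block \<open>r\<close> is joined to two opposite corners of a face of the cube.\<close>

definition layer :: "nat \<Rightarrow> nat \<Rightarrow> nat" where
  "layer u v = (if even v \<longleftrightarrow> u mod 4 < 2 then v div 4 else u div 4)"

lemma planar_layer:
  "planar ({0..<n} \<times> {0..<2::nat})
     {{(u, 0::nat), (v, 1)} | u v. u < n \<and> v < n \<and> u \<noteq> v \<and> layer u v = r}"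
proof (rule planar_coded[where code = "layer_code r"])
  have mod4: "x mod 4 = 0 \<or> x mod 4 = 1 \<or> x mod 4 = 2 \<or> x mod 4 = 3" for x :: nat by auto
  have oddm: "odd x \<longleftrightarrow> odd (x mod 4)" for x :: nat by presburger
  show "inj_on (layer_code r) ({0..<n} \<times> {0..<2::nat})"
  proof (rule inj_onI, clarify)
    fix x s y s' assume s: "s \<in> {0..<2::nat}" "s' \<in> {0..<2::nat}"
      and eq: "layer_code r (x, s) = layer_code r (y, s')"
    have s: "s = 0 \<or> s = 1" "s' = 0 \<or> s' = 1" using s by auto
    show "x = y \<and> s = s'"
    proof (cases "x div 4 = r \<and> y div 4 = r")
      case True
      then have "x mod 4 = y mod 4 \<and> s = s'"
        using eq s mod4[of x] mod4[of y] by auto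
      then show ?thesis using True by (metis div_mult_mod_eq)
    next
      case False
      then have "x div 4 \<noteq> r" "y div 4 \<noteq> r"
        using eq s mod4[of x] mod4[of y] by (auto split: if_splits)
      then show ?thesis using eq s by (auto split: if_splits)
    qed
  qed
  show "fst (layer_code r v) < 4 \<and> vertex_piece (snd (layer_code r v))"
    if "v \<in> {0..<n} \<times> {0..<2::nat}" for v
  proof -
    obtain x s where "v = (x, s)" by (cases v)
    then show ?thesis using mod4[of x] by auto
  qed
  show "e \<subseteq> {0..<n} \<times> {0..<2::nat} \<and> card e = 2"
    if "e \<in> {{(u, 0::nat), (v, 1)} | u v. u < n \<and> v < n \<and> u \<noteq> v \<and> layer u v = r}" for e
    using that by auto
  show "\<exists>k p. k < 4 \<and> edge_piece p \<and> layer_code r ` e = piece_ends k p"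
    if eL: "e \<in> {{(u, 0::nat), (v, 1)} | u v. u < n \<and> v < n \<and> u \<noteq> v \<and> layer u v = r}" for e
  proof -
    obtain u v where e: "e = {(u, 0), (v, 1)}" and uv: "u \<noteq> v" "layer u v = r" using eL by auto
    have le: "layer_code r ` e = {layer_code r (u, 0), layer_code r (v, 1)}" by (simp add: e)
    have tt: "0 < 1 / (real x + 2) \<and> 1 / (real x + 2) < 1" for x by simp
    \<comment> \<open>\<open>layer u v\<close> is the block of \<open>u\<close> or of
      \<open>v\<close>, so an edge of layer \<open>r\<close> has an end in block
      \<open>r\<close>.\<close>
    consider "u div 4 = r" "v div 4 = r" | "u div 4 \<noteq> r" "v div 4 = r" | "u div 4 = r" "v div 4 \<noteq> r"
      using uv by (auto simp: layer_def split: if_splits)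
    then show ?thesis
    proof cases
      case 1
      \<comment> \<open>Different vertices of one block have different residues; the twelve ordered
        pairs of residues give the twelve edges of the cube.\<close>
      then have "u mod 4 \<noteq> v mod 4" using uv by (metis div_mult_mod_eq)
      then have "\<exists>k\<in>{0, 1, 2, 3}. \<exists>p\<in>{Spoke, Inner, Outer}. layer_code r ` e = piece_ends k p"
        unfolding le using 1 mod4[of u] mod4[of v]
        by (elim disjE) (simp_all add: doubleton_eq_iff)
      then obtain k p where kp: "k \<in> {0, 1, 2, 3}" "p \<in> {Spoke, Inner, Outer}"
        "layer_code r ` e = piece_ends k p" by (elim bexE)
      then have "k < 4" "edge_piece p" by auto
      then show ?thesis using kp(3) by (intro exI conjI)
    next
      case 2
      \<comment> \<open>As \<open>u\<close> is not in block \<open>r\<close>, the first branch of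
        \<open>layer\<close> applies; its parity condition selects the two corners of the face of
        \<open>(u, 0)\<close> that are joined to it.\<close>
      then have "even v \<longleftrightarrow> u mod 4 < 2" using uv by (auto simp: layer_def split: if_splits)
      then have "\<exists>k\<in>{0, 1, 2, 3}. \<exists>p\<in>{Low (1 / (real u + 2)), High (1 / (real u + 2))}. layer_code r ` e = piece_ends k p"
        unfolding le using 2 mod4[of u] mod4[of v] oddm[of v]
        by (elim disjE) (simp_all add: doubleton_eq_iff)
      then obtain k p where kp: "k \<in> {0, 1, 2, 3}" "p \<in> {Low (1 / (real u + 2)), High (1 / (real u + 2))}"
        "layer_code r ` e = piece_ends k p" by (elim bexE)
      then have "k < 4" "edge_piece p" using tt[of u] by auto
      then show ?thesis using kp(3) by (intro exI conjI)
    next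
      case 3
      then have "\<not> (even v \<longleftrightarrow> u mod 4 < 2)" using uv by (auto simp: layer_def split: if_splits)
      then have "\<exists>k\<in>{0, 1, 2, 3}. \<exists>p\<in>{Low (1 / (real v + 2)), High (1 / (real v + 2))}. layer_code r ` e = piece_ends k p"
        unfolding le using 3 mod4[of u] mod4[of v] oddm[of v]
        by (elim disjE) (simp_all add: doubleton_eq_iff)
      then obtain k p where kp: "k \<in> {0, 1, 2, 3}" "p \<in> {Low (1 / (real v + 2)), High (1 / (real v + 2))}"
        "layer_code r ` e = piece_ends k p" by (elim bexE)
      then have "k < 4" "edge_piece p" using tt[of v] by auto
      then show ?thesis using kp(3) by (intro exI conjI)
    qed
  qed
qed

section \<open>The thickness\<close>

theorem theorem3p3:
  fixes n :: nat
  assumes "n \<ge> 2"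
  shows "thickness ({0..<n} \<times> {0..<2::nat})
           (kron_edges (complete_edges {0..<n}) (complete_edges {0..<2::nat}))
         = nat \<lceil>real n / 4\<rceil>"
proof -
  let ?V = "{0..<n} \<times> {0..<2::nat}"
  let ?E = "kron_edges (complete_edges {0..<n}) (complete_edges {0..<2::nat})"
  \<comment> \<open>Turns the ceiling into a linear inequality, for both the covering and the
    counting argument.\<close>
  have le_iff: "nat \<lceil>real n / 4\<rceil> \<le> k \<longleftrightarrow> n \<le> 4 * k" for k
    by (simp add: nat_le_iff ceiling_le_iff) linarith
  show ?thesis
    unfolding thickness_def
  proof (rule Least_equality)
    let ?F = "\<lambda>r. {{(u, 0::nat), (v, 1)} | u v. u < n \<and> v < n \<and> u \<noteq> v \<and> layer u v = r}"
    let ?p = "nat \<lceil>real n / 4\<rceil>"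
    have sub: "?F r \<subseteq> ?E" for r unfolding kron_complete_K2 by blast
    have union: "(\<Union>r<?p. ?F r) = ?E"
    proof (intro equalityI subsetI)
      fix e assume "e \<in> ?E"
      then obtain u v where e: "e = {(u, 0), (v, 1)}" "u < n" "v < n" "u \<noteq> v"
        unfolding kron_complete_K2 by blast
      have "n \<le> 4 * ?p" using le_iff by blast
      then have "layer u v < ?p" using e by (auto simp: layer_def)
      then show "e \<in> (\<Union>r<?p. ?F r)" using e by blast
    qed (use sub in blast)
    show "\<exists>F. (\<forall>i<?p. F i \<subseteq> ?E \<and> planar ?V (F i)) \<and> (\<Union>i<?p. F i) = ?E"
      by (intro exI[of _ ?F] conjI allI impI sub planar_layer union)
  next
    fix k :: nat assume "\<exists>F. (\<forall>i<k. F i \<subseteq> ?E \<and> planar ?V (F i)) \<and> (\<Union>i<k. F i) = ?E"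
    then obtain F where F: "\<And>i. i < k \<Longrightarrow> F i \<subseteq> ?E" "\<And>i. i < k \<Longrightarrow> planar ?V (F i)"
      and U: "(\<Union>i<k. F i) = ?E" by blast
    have cV: "card ?V = 2 * n" by simp
    have bound: "card (F i) \<le> 4 * n - 2" if i: "i < k" for i
    proof -
      have Fi: "\<exists>u v. e = {(u, 0), (v, 1)} \<and> u < n \<and> v < n" if "e \<in> F i" for e
        using F(1)[OF i] that unfolding kron_complete_K2 by blast
      have "card (F i) + 2 \<le> 2 * card ?V"
      proof (rule planar_triangle_free_card_edges[OF F(2)[OF i]])
        show "simple_graph ?V (F i)" unfolding simple_graph_def using Fi by fastforce
        show "2 \<le> card ?V" using assms cV by simp
        show "\<not> cycle_edges vs \<subseteq> F i" if "length vs = 3" for vs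
        proof (rule bipartite_no_triangle[OF _ that, where c = "\<lambda>x. snd x = 0"])
          fix e assume "e \<in> F i"
          then show "\<exists>x y. e = {x, y} \<and> (snd x = 0) \<noteq> (snd y = 0)"
            using Fi by (metis snd_conv zero_neq_one)
        qed
      qed
      then show ?thesis using cV by simp
    qed
    have "n * (n - 1) = card (\<Union>i<k. F i)" unfolding U card_kron_complete_K2 ..
    also have "\<dots> \<le> (\<Sum>i<k. card (F i))" by (rule card_UN_le) simp
    also have "\<dots> \<le> (\<Sum>i<k. 4 * n - 2)" using bound by (intro sum_mono) simp
    finally have total: "n * (n - 1) \<le> k * (4 * n - 2)" by simp
    have "n \<le> 4 * k"
    proof (rule ccontr)
      assume "\<not> n \<le> 4 * k"
      then have kn: "4 * k \<le> n - 1" by simp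
      have "0 < n * (n - 1)" using assms by simp
      \<comment> \<open>Positivity of \<open>k\<close> makes the next inequality strict. The 2 in
        \<open>4 * n - 2\<close> provides the strictness, without which \<open>4 * k = n - 1\<close>
        would be no contradiction.\<close>
      then have "k > 0" using total by (cases k) auto
      then have "k * (4 * n - 2) < k * (4 * n)" using assms by simp
      also have "\<dots> = n * (4 * k)" by simp
      also have "\<dots> \<le> n * (n - 1)" using kn by (rule mult_le_mono2)
      finally show False using total by simp
    qed
    then show "nat \<lceil>real n / 4\<rceil> \<le> k" using le_iff by blast
  qed
qed

end
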